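(* Let $\gamma = 3$ and let $(\sigma_0,\beta_0) \in L^\infty(\mathbb{R}) \cap C^1(\mathbb{R})$ satisfy $$\inf_{\mathbb{R}} (\sigma_0 - |\beta_0| ) > 0.$$ Then there exists a unique global $C^1$ solution $(\sigma,\beta)$ of the isentropic Carrollian fluid equations with $\gamma=3$ and initial data $(\sigma_0,\beta_0)$ if and only if $$(\beta_0 + \sigma_0)_x \leq 0 \quad \text{and} \quad ( \beta_0 - \sigma_0 )_x \leq 0 \quad \text{everywhere on } \mathbb{R}. \qquad ( * )$$ If condition $( * )$ fails, then the solution ceases to be $C^1$ at the time $$T^* = \min\bigg\{ \inf_{\{x\in\mathbb{R}:\,(\beta_0+\sigma_0)_x(x)>0\}}\frac{(\beta_0 + \sigma_0)^2}{(\beta_0+\sigma_0)_{x}} , \ \inf_{\{x\in\mathbb{R}:\,(\beta_0-\sigma_0)_x(x)>0\}} \frac{(\beta_0-\sigma_0)^2}{(\beta_0-\sigma_0)_{x}} \bigg\},$$ where the infimum over the empty set is $+\infty$. Furthermore, for all $t \in (0,T^* )$, there hold the one-sided Lipschitz bounds $$\inf_{\mathbb{R}}(\beta + \sigma)_x (t,\cdot) \geq - \frac{\sup_{\mathbb{R}}(\sigma_0+|\beta_0|)^2}{t} \quad\text{and}\quad \inf_{\mathbb{R}}(\beta - \sigma)_x (t,\cdot) \geq - \frac{\sup_{\mathbb{R}}(\sigma_0+|\beta_0|)^2}{t}.$$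
   Context: The isentropic Carrollian fluid equations with exponent $\gamma$, for unknowns $\sigma,\beta$ depending on $(t,x)$ with $t>0$, $x\in\mathbb{R}$, are $$\partial_t (\sigma \beta) + \partial_x \sigma = 0, \qquad \partial_t \left(\gamma^{-1} \sigma^\gamma + \sigma \beta^2\right) + \partial_x (\sigma \beta) = 0.$$ Let $T>0$ and $(\sigma_0,\beta_0)\in C^1(\mathbb{R})$ with $\sigma_0\ge 0$. A pair $(\sigma,\beta)$ is a $C^1$ solution on $(0,T)\times\mathbb{R}$ if $\sigma,\beta\in C^1([0,T)\times\mathbb{R})$, $\sigma\ge 0$ on $[0,T)\times\mathbb{R}$, and the equations hold pointwise for all $(t,x)\in(0,T)\times\mathbb{R}$; it has initial data $(\sigma_0,\beta_0)$ if in addition $(\sigma(0,x),\beta(0,x))=(\sigma_0(x),\beta_0(x))$ for all $x\in\mathbb{R}$. It is a global $C^1$ solution if it is a $C^1$ solution on $(0,T)\times\mathbb{R}$ for all $T>0$. The time at which the solution ceases to be $C^1$ is the supremum of those $T>0$ for which a $C^1$ solution with the given initial data exists on $(0,T)\times\mathbb{R}$ (with supremum of the empty set equal to $0$). The subscript $x$ denotes the derivative with respect to $x$. *)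

theory Defs
  imports "HOL-Analysis.Analysis"
begin

text \<open>The space \<open>L\<^sup>\<infinity>(\<real>)\<close>.\<close>

definition Linfinity :: "(real \<Rightarrow> real) \<Rightarrow> bool" where
  "Linfinity f \<longleftrightarrow>
     f \<in> borel_measurable lebesgue \<and> (\<exists>C. AE x in lebesgue. \<bar>f x\<bar> \<le> C)"

text \<open>
  Functions of \<open>(t, x)\<close> are curried. The derivative is taken within \<open>S\<close>, so that for
  \<open>S = [0,T) \<times> \<real>\<close> it is one-sided in time at \<open>t = 0\<close>, and values at negative times are irrelevant.
\<close>

definition C1_on :: "(real \<times> real) set \<Rightarrow> (real \<Rightarrow> real \<Rightarrow> real) \<Rightarrow> bool" where
  "C1_on S u \<longleftrightarrow>
     (\<exists>D :: real \<times> real \<Rightarrow> (real \<times> real) \<Rightarrow>\<^sub>L real.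
        (\<forall>p\<in>S. ((\<lambda>(t, x). u t x) has_derivative blinfun_apply (D p)) (at p within S)) \<and>
        continuous_on S D)"

text \<open>
  \<open>\<partial>\<^sub>t q + \<partial>\<^sub>x f = 0\<close> at the point \<open>(t, x)\<close>, including the existence of the two partial derivatives.
\<close>

definition conservation_law_at ::
    "(real \<Rightarrow> real \<Rightarrow> real) \<Rightarrow> (real \<Rightarrow> real \<Rightarrow> real) \<Rightarrow> real \<Rightarrow> real \<Rightarrow> bool" where
  "conservation_law_at q f t x \<longleftrightarrow>
     (\<exists>a b. ((\<lambda>s. q s x) has_real_derivative a) (at t) \<and>
            ((\<lambda>y. f t y) has_real_derivative b) (at x) \<and> a + b = 0)"

definition carroll_equations_at ::
    "real \<Rightarrow> (real \<Rightarrow> real \<Rightarrow> real) \<Rightarrow> (real \<Rightarrow> real \<Rightarrow> real) \<Rightarrow> real \<Rightarrow> real \<Rightarrow> bool" where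
  "carroll_equations_at \<gamma> \<sigma> \<beta> t x \<longleftrightarrow>
     conservation_law_at (\<lambda>s y. \<sigma> s y * \<beta> s y) \<sigma> t x \<and>
     conservation_law_at (\<lambda>s y. inverse \<gamma> * \<sigma> s y powr \<gamma> + \<sigma> s y * (\<beta> s y)\<^sup>2)
       (\<lambda>s y. \<sigma> s y * \<beta> s y) t x"

definition C1_solution ::
    "real \<Rightarrow> real \<Rightarrow> (real \<Rightarrow> real \<Rightarrow> real) \<Rightarrow> (real \<Rightarrow> real \<Rightarrow> real) \<Rightarrow> bool" where
  "C1_solution \<gamma> T \<sigma> \<beta> \<longleftrightarrow>
     C1_on ({0..<T} \<times> UNIV) \<sigma> \<and> C1_on ({0..<T} \<times> UNIV) \<beta> \<and>
     (\<forall>t\<in>{0..<T}. \<forall>x. 0 \<le> \<sigma> t x) \<and>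
     (\<forall>t\<in>{0<..<T}. \<forall>x. carroll_equations_at \<gamma> \<sigma> \<beta> t x)"

definition has_initial_data ::
    "(real \<Rightarrow> real \<Rightarrow> real) \<Rightarrow> (real \<Rightarrow> real \<Rightarrow> real) \<Rightarrow> (real \<Rightarrow> real) \<Rightarrow> (real \<Rightarrow> real) \<Rightarrow> bool" where
  "has_initial_data \<sigma> \<beta> \<sigma>\<^sub>0 \<beta>\<^sub>0 \<longleftrightarrow> (\<forall>x. \<sigma> 0 x = \<sigma>\<^sub>0 x \<and> \<beta> 0 x = \<beta>\<^sub>0 x)"

definition global_C1_solution ::
    "real \<Rightarrow> (real \<Rightarrow> real \<Rightarrow> real) \<Rightarrow> (real \<Rightarrow> real \<Rightarrow> real) \<Rightarrow> bool" where
  "global_C1_solution \<gamma> \<sigma> \<beta> \<longleftrightarrow> (\<forall>T>0. C1_solution \<gamma> T \<sigma> \<beta>)"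

text \<open>Uniqueness means equality on \<open>[0,\<infinity>) \<times> \<real>\<close>, the domain of a global solution.\<close>

definition unique_global_C1_solution ::
    "real \<Rightarrow> (real \<Rightarrow> real) \<Rightarrow> (real \<Rightarrow> real) \<Rightarrow> bool" where
  "unique_global_C1_solution \<gamma> \<sigma>\<^sub>0 \<beta>\<^sub>0 \<longleftrightarrow>
     (\<exists>\<sigma> \<beta>. global_C1_solution \<gamma> \<sigma> \<beta> \<and> has_initial_data \<sigma> \<beta> \<sigma>\<^sub>0 \<beta>\<^sub>0 \<and>
        (\<forall>\<sigma>' \<beta>'. global_C1_solution \<gamma> \<sigma>' \<beta>' \<and> has_initial_data \<sigma>' \<beta>' \<sigma>\<^sub>0 \<beta>\<^sub>0 \<longrightarrow>
           (\<forall>t\<ge>0. \<forall>x. \<sigma>' t x = \<sigma> t x \<and> \<beta>' t x = \<beta> t x)))"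

text \<open>
  The time at which the solution ceases to be \<open>C\<^sup>1\<close>. Inserting \<open>0\<close> makes the supremum \<open>0\<close>
  (and not \<open>-\<infinity>\<close>) if there is no \<open>C\<^sup>1\<close> solution for any \<open>T > 0\<close>.
\<close>

definition C1_lifespan :: "real \<Rightarrow> (real \<Rightarrow> real) \<Rightarrow> (real \<Rightarrow> real) \<Rightarrow> ereal" where
  "C1_lifespan \<gamma> \<sigma>\<^sub>0 \<beta>\<^sub>0 =
     Sup (insert 0 (ereal ` {T. 0 < T \<and>
       (\<exists>\<sigma> \<beta>. C1_solution \<gamma> T \<sigma> \<beta> \<and> has_initial_data \<sigma> \<beta> \<sigma>\<^sub>0 \<beta>\<^sub>0)}))"

text \<open>In \<^typ>\<open>ereal\<close> the infimum over the empty set is \<open>\<infinity>\<close>.\<close>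

definition blowup_time :: "(real \<Rightarrow> real) \<Rightarrow> (real \<Rightarrow> real) \<Rightarrow> ereal" where
  "blowup_time \<sigma>\<^sub>0 \<beta>\<^sub>0 =
     min (INF x\<in>{x. deriv (\<lambda>y. \<beta>\<^sub>0 y + \<sigma>\<^sub>0 y) x > 0}.
            ereal ((\<beta>\<^sub>0 x + \<sigma>\<^sub>0 x)\<^sup>2 / deriv (\<lambda>y. \<beta>\<^sub>0 y + \<sigma>\<^sub>0 y) x))
         (INF x\<in>{x. deriv (\<lambda>y. \<beta>\<^sub>0 y - \<sigma>\<^sub>0 y) x > 0}.
            ereal ((\<beta>\<^sub>0 x - \<sigma>\<^sub>0 x)\<^sup>2 / deriv (\<lambda>y. \<beta>\<^sub>0 y - \<sigma>\<^sub>0 y) x))"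

end

theory Submission
  imports Defs
begin

text \<open>For \<open>\<gamma> = 3\<close> the Riemann invariants \<open>w = \<beta> + \<sigma>\<close> and \<open>z = \<beta> - \<sigma>\<close> decouple: away from vacuum each
  solves \<open>v v\<^sub>t + v\<^sub>x = 0\<close>, so \<open>v\<close> is constant on the line \<open>x = y + t / v\<^sub>0(y)\<close>. Differentiating along the
  initial points, \<open>v\<^sub>x (1 - t v\<^sub>0' / v\<^sub>0\<^sup>2) = v\<^sub>0'\<close>, which gives the blow-up time and the one-sided
  bounds. Vacuum cannot form: in the backward cone of a bad point, an earliest point with \<open>w \<le> c / 2\<close> or
  \<open>z \<ge> - c / 2\<close> is connected to the initial line by characteristics on which \<open>w\<close> and \<open>z\<close> are constant.\<close>

text \<open>The obstacle is circular: a solution is only known to satisfy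
  \<open>\<sigma> \<ge> 0\<close>, the decoupled equations arise after cancelling a factor
  \<open>\<sigma>\<close>, and the positivity of \<open>\<sigma>\<close> has to come from those
  equations. No bound at positive times is given either, and the speed \<open>1 / v\<close> is
  unbounded near \<open>v = 0\<close>. The uniform gap \<open>c\<close> between the data and vacuum
  resolves this: while both invariants keep distance \<open>c / 2\<close> from zero, all speeds are
  at most \<open>2 / c\<close>, so the backward cones are compact. The same gap bounds the speeds in
  the construction and makes every point lie on a characteristic. Existence and breakdown match
  exactly: the derivative of the characteristic map \<open>y + t / v\<^sub>0 y\<close> is positive
  for all \<open>t < T\<close> if and only if \<open>T\<close> times the slope of
  \<open>v\<^sub>0\<close> never exceeds the square of \<open>v\<^sub>0\<close>.\<close>

text \<open>Gronwall's argument: \<open>g\<close> squared, weighted by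
  \<open>exp (- 2 * K * t)\<close>, does not increase to the right of \<open>s\<close>; weighted by
  \<open>exp (2 * K * t)\<close>, it does not decrease to the left of \<open>s\<close>. Both
  directions occur because characteristics are followed away from the initial line and back to it.
  Derivatives are taken in the open interval, as the equations are not imposed at time 0.\<close>

lemma linear_ode_zero:
  fixes g g' :: "real \<Rightarrow> real"
  assumes cont: "continuous_on {a..b} g"
    and der: "\<And>t. a < t \<Longrightarrow> t < b \<Longrightarrow> (g has_real_derivative g' t) (at t)"
    and bound: "\<And>t. a < t \<Longrightarrow> t < b \<Longrightarrow> \<bar>g' t\<bar> \<le> K * \<bar>g t\<bar>"
    and s: "s \<in> {a..b}" "g s = 0" and t: "t \<in> {a..b}"
  shows "g t = 0"
proof -
  have prod: "\<bar>g r * g' r\<bar> \<le> K * (g r)\<^sup>2" if "a < r" "r < b" for r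
    using mult_left_mono[OF bound[OF that], of "\<bar>g r\<bar>"]
    by (simp add: abs_mult power2_eq_square mult.left_commute)
  show ?thesis
  proof (cases "s \<le> t")
    case True
    have "(g t)\<^sup>2 * exp (- 2 * K * t) \<le> (g s)\<^sup>2 * exp (- 2 * K * s)"
    proof (rule DERIV_nonpos_imp_decreasing_open[OF True])
      fix r assume r: "s < r" "r < t"
      have "((\<lambda>r. (g r)\<^sup>2 * exp (- 2 * K * r)) has_real_derivative
          2 * (g r * g' r - K * (g r)\<^sup>2) * exp (- 2 * K * r)) (at r)"
        using r s t by (auto intro!: derivative_eq_intros der simp: algebra_simps)
      moreover have "2 * (g r * g' r - K * (g r)\<^sup>2) * exp (- 2 * K * r) \<le> 0"
        using prod[of r] r s t by (auto intro!: mult_nonpos_nonneg)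
      ultimately show "\<exists>y. ((\<lambda>r. (g r)\<^sup>2 * exp (- 2 * K * r)) has_real_derivative y) (at r) \<and> y \<le> 0"
        by blast
    qed (use s t in \<open>auto intro!: continuous_intros continuous_on_subset[OF cont]\<close>)
    then show ?thesis using s by (simp add: mult_le_0_iff)
  next
    case False
    then have "t \<le> s" by simp
    have "(g t)\<^sup>2 * exp (2 * K * t) \<le> (g s)\<^sup>2 * exp (2 * K * s)"
    proof (rule DERIV_nonneg_imp_increasing_open[OF \<open>t \<le> s\<close>])
      fix r assume r: "t < r" "r < s"
      have "((\<lambda>r. (g r)\<^sup>2 * exp (2 * K * r)) has_real_derivative
          2 * (g r * g' r + K * (g r)\<^sup>2) * exp (2 * K * r)) (at r)"
        using r s t by (auto intro!: derivative_eq_intros der simp: algebra_simps)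
      moreover have "2 * (g r * g' r + K * (g r)\<^sup>2) * exp (2 * K * r) \<ge> 0"
        using prod[of r] r s t by (auto intro!: mult_nonneg_nonneg)
      ultimately show "\<exists>y. ((\<lambda>r. (g r)\<^sup>2 * exp (2 * K * r)) has_real_derivative y) (at r) \<and> y \<ge> 0"
        by blast
    qed (use s t in \<open>auto intro!: continuous_intros continuous_on_subset[OF cont]\<close>)
    then show ?thesis using s by (simp add: mult_le_0_iff)
  qed
qed

section \<open>Functions of class C^1 through their partial derivatives\<close>

text \<open>Names the two partial derivatives so that they can enter the equations; in
  \<open>C1_on\<close> they are hidden in an operator-valued map. Differentiation stays within
  \<open>S\<close>, which keeps it one-sided at time 0.\<close>

definition C1_partials ::
    "(real \<times> real) set \<Rightarrow> (real \<Rightarrow> real \<Rightarrow> real) \<Rightarrow> (real \<times> real \<Rightarrow> real) \<Rightarrow>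
      (real \<times> real \<Rightarrow> real) \<Rightarrow> bool" where
  "C1_partials S u p q \<longleftrightarrow>
     (\<forall>z\<in>S. ((\<lambda>(t, x). u t x) has_derivative (\<lambda>h. p z * fst h + q z * snd h)) (at z within S)) \<and>
     continuous_on S p \<and> continuous_on S q"

lemma C1_on_iff_partials: "C1_on S u \<longleftrightarrow> (\<exists>p q. C1_partials S u p q)"
proof
  assume "C1_on S u"
  then obtain D :: "real \<times> real \<Rightarrow> (real \<times> real) \<Rightarrow>\<^sub>L real" where
    D: "\<And>z. z \<in> S \<Longrightarrow> ((\<lambda>(t, x). u t x) has_derivative blinfun_apply (D z)) (at z within S)"
    and cont: "continuous_on S D"
    unfolding C1_on_def by blast
  have eq: "blinfun_apply (D z) = (\<lambda>h. blinfun_apply (D z) (1, 0) * fst h + blinfun_apply (D z) (0, 1) * snd h)" for z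
  proof
    fix h :: "real \<times> real"
    have "h = fst h *\<^sub>R (1, 0) + snd h *\<^sub>R (0, 1)" by (cases h) simp
    then have "blinfun_apply (D z) h = blinfun_apply (D z) (fst h *\<^sub>R (1, 0) + snd h *\<^sub>R (0, 1))" by simp
    also have "\<dots> = blinfun_apply (D z) (1, 0) * fst h + blinfun_apply (D z) (0, 1) * snd h"
      by (simp only: blinfun.add_right blinfun.scaleR_right) (simp add: mult.commute)
    finally show "blinfun_apply (D z) h = blinfun_apply (D z) (1, 0) * fst h + blinfun_apply (D z) (0, 1) * snd h" .
  qed
  have "C1_partials S u (\<lambda>z. blinfun_apply (D z) (1, 0)) (\<lambda>z. blinfun_apply (D z) (0, 1))"
    unfolding C1_partials_def using D eq
    by (auto intro!: continuous_intros cont)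
  then show "\<exists>p q. C1_partials S u p q" by blast
next
  assume "\<exists>p q. C1_partials S u p q"
  then obtain p q where pq: "C1_partials S u p q" by blast
  define D where "D z = p z *\<^sub>R Blinfun (fst :: real \<times> real \<Rightarrow> real) + q z *\<^sub>R Blinfun snd" for z
  have "blinfun_apply (D z) = (\<lambda>h. p z * fst h + q z * snd h)" for z
    unfolding D_def
    by (auto simp: blinfun.add_left blinfun.scaleR_left bounded_linear_Blinfun_apply
        bounded_linear_fst bounded_linear_snd)
  moreover have "continuous_on S D"
    using pq unfolding D_def C1_partials_def by (auto intro!: continuous_intros)
  ultimately show "C1_on S u"
    using pq unfolding C1_on_def C1_partials_def by (intro exI[of _ D]) auto
qed

lemma C1_partials_linear:
  assumes "C1_partials S u p q" and "C1_partials S v p' q'"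
  shows "C1_partials S (\<lambda>t x. a * u t x + b * v t x)
    (\<lambda>z. a * p z + b * p' z) (\<lambda>z. a * q z + b * q' z)"
  unfolding C1_partials_def
proof (intro conjI ballI)
  fix z assume z: "z \<in> S"
  have "((\<lambda>z. a * (case z of (t, x) \<Rightarrow> u t x) + b * (case z of (t, x) \<Rightarrow> v t x)) has_derivative
      (\<lambda>h. a * (p z * fst h + q z * snd h) + b * (p' z * fst h + q' z * snd h))) (at z within S)"
    using assms z unfolding C1_partials_def
    by (intro has_derivative_add has_derivative_mult_right) auto
  then show "((\<lambda>(t, x). a * u t x + b * v t x) has_derivative
      (\<lambda>h. (a * p z + b * p' z) * fst h + (a * q z + b * q' z) * snd h)) (at z within S)"
    by (simp add: case_prod_unfold algebra_simps)
qed (use assms in \<open>auto simp: C1_partials_def intro!: continuous_intros\<close>)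

lemma C1_partials_continuous:
  assumes "C1_partials S u p q"
  shows "continuous_on S (\<lambda>(t, x). u t x)"
  using assms has_derivative_continuous
  unfolding C1_partials_def continuous_on_eq_continuous_within by blast

lemma C1_partials_continuous_curve:
  assumes "C1_partials ({0..<T} \<times> UNIV) u p q" and "continuous_on A X" and "A \<subseteq> {0..<T}"
  shows "continuous_on A (\<lambda>t. u t (X t))" and "continuous_on A (\<lambda>t. p (t, X t))"
proof -
  have "continuous_on A (\<lambda>t. f (t, X t))" if "continuous_on ({0..<T} \<times> UNIV) f"
    for f :: "real \<times> real \<Rightarrow> real"
    using assms(2,3)
    by (intro continuous_on_compose2[OF that]) (auto intro!: continuous_intros)
  from this[OF C1_partials_continuous[OF assms(1)]] this[of p] assms(1)
  show "continuous_on A (\<lambda>t. u t (X t))" "continuous_on A (\<lambda>t. p (t, X t))"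
    by (auto simp: C1_partials_def)
qed

lemma C1_partials_has_derivative_at:
  assumes "C1_partials ({0..<T} \<times> UNIV) u p q" and "0 < t" "t < T"
  shows "((\<lambda>(t, x). u t x) has_derivative (\<lambda>h. p (t, x) * fst h + q (t, x) * snd h)) (at (t, x))"
proof -
  have "((\<lambda>(t, x). u t x) has_derivative (\<lambda>h. p (t, x) * fst h + q (t, x) * snd h))
      (at (t, x) within ({0..<T} \<times> UNIV))"
    using assms unfolding C1_partials_def by auto
  then have "((\<lambda>(t, x). u t x) has_derivative (\<lambda>h. p (t, x) * fst h + q (t, x) * snd h))
      (at (t, x) within ({0<..<T} \<times> UNIV))"
    by (rule has_derivative_subset) auto
  moreover have "open ({0<..<T} \<times> (UNIV :: real set))"
    by (intro open_Times) auto
  ultimately show ?thesis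
    using assms by (subst (asm) at_within_open) auto
qed

text \<open>Serves three purposes: constant \<open>\<tau>\<close> gives the derivative in space,
  constant \<open>X\<close> the one in time, and the identity as \<open>\<tau>\<close> the
  derivative along a characteristic.\<close>

lemma C1_partials_chain:
  assumes "C1_partials ({0..<T} \<times> UNIV) u p q" and "0 < \<tau> s" "\<tau> s < T"
    and "(\<tau> has_real_derivative \<tau>') (at s)" and "(X has_real_derivative X') (at s)"
  shows "((\<lambda>s. u (\<tau> s) (X s)) has_real_derivative
    p (\<tau> s, X s) * \<tau>' + q (\<tau> s, X s) * X') (at s)"
proof -
  have "((\<lambda>s. (\<tau> s, X s)) has_derivative (\<lambda>h. (\<tau>' * h, X' * h))) (at s)"
    using assms(4,5) by (auto simp: has_field_derivative_def intro!: has_derivative_Pair)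
  from has_derivative_compose[OF this C1_partials_has_derivative_at[OF assms(1-3)]] show ?thesis
    by (simp add: has_field_derivative_def) (erule has_derivative_eq_rhs, auto simp: algebra_simps)
qed

text \<open>On the line through \<open>(t\<^sub>0, x\<^sub>0)\<close> with slope \<open>1 / m\<close>, the equation makes \<open>v - m\<close>
  solve a linear ordinary differential equation with coefficient \<open>- p / m\<close>.\<close>

lemma constant_on_characteristic:
  assumes v: "C1_partials ({0..<T} \<times> UNIV) v p q" and "t\<^sub>1 < T"
    and t0: "t\<^sub>0 \<in> {0..t\<^sub>1}" and m: "m = v t\<^sub>0 x\<^sub>0" "m \<noteq> 0"
    and eq: "\<And>t. 0 < t \<Longrightarrow> t < t\<^sub>1 \<Longrightarrow>
      v t (x\<^sub>0 + (t - t\<^sub>0) / m) * p (t, x\<^sub>0 + (t - t\<^sub>0) / m) + q (t, x\<^sub>0 + (t - t\<^sub>0) / m) = 0"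
    and t: "t \<in> {0..t\<^sub>1}"
  shows "v t (x\<^sub>0 + (t - t\<^sub>0) / m) = m"
proof -
  define X where "X t = x\<^sub>0 + (t - t\<^sub>0) / m" for t
  have contX: "continuous_on A X" for A
    unfolding X_def using m by (auto intro!: continuous_intros)
  have cont: "continuous_on {0..t\<^sub>1} (\<lambda>t. v t (X t))" "continuous_on {0..t\<^sub>1} (\<lambda>t. p (t, X t))"
    using \<open>t\<^sub>1 < T\<close> by (auto intro!: C1_partials_continuous_curve[OF v contX])
  obtain B where B: "\<And>t. t \<in> {0..t\<^sub>1} \<Longrightarrow> \<bar>p (t, X t)\<bar> \<le> B"
    using compact_imp_bounded[OF compact_continuous_image[OF cont(2) compact_Icc]]
    unfolding bounded_iff real_norm_def by blast
  have "v t (X t) - m = 0"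
  proof (rule linear_ode_zero[where g = "\<lambda>t. v t (X t) - m" and a = 0 and b = t\<^sub>1
        and g' = "\<lambda>t. (m - v t (X t)) * p (t, X t) / m" and K = "B / \<bar>m\<bar>" and s = t\<^sub>0])
    fix t assume "0 < t" "t < t\<^sub>1"
    have "(X has_real_derivative 1 / m) (at t)"
      unfolding X_def using m(2) by (auto intro!: derivative_eq_intros)
    then have "((\<lambda>t. v t (X t)) has_real_derivative p (t, X t) * 1 + q (t, X t) * (1 / m)) (at t)"
      using \<open>0 < t\<close> \<open>t < t\<^sub>1\<close> \<open>t\<^sub>1 < T\<close> by (intro C1_partials_chain[OF v]) auto
    moreover have "p (t, X t) * 1 + q (t, X t) * (1 / m) = (m - v t (X t)) * p (t, X t) / m"
      using eq[OF \<open>0 < t\<close> \<open>t < t\<^sub>1\<close>] m unfolding X_def[symmetric] by (simp add: field_simps)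
    ultimately show "((\<lambda>t. v t (X t) - m) has_real_derivative (m - v t (X t)) * p (t, X t) / m) (at t)"
      by (auto intro!: derivative_eq_intros)
    have "\<bar>m - v t (X t)\<bar> * \<bar>p (t, X t)\<bar> \<le> \<bar>m - v t (X t)\<bar> * B"
      using B[of t] \<open>0 < t\<close> \<open>t < t\<^sub>1\<close> by (intro mult_left_mono) auto
    then have "\<bar>m - v t (X t)\<bar> * \<bar>p (t, X t)\<bar> / \<bar>m\<bar> \<le> \<bar>m - v t (X t)\<bar> * B / \<bar>m\<bar>"
      by (rule divide_right_mono) simp
    then show "\<bar>(m - v t (X t)) * p (t, X t) / m\<bar> \<le> B / \<bar>m\<bar> * \<bar>v t (X t) - m\<bar>"
      by (simp add: abs_mult abs_minus_commute mult.commute)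
  qed (use cont t0 t m in \<open>auto intro!: continuous_intros simp: X_def\<close>)
  then show ?thesis by (simp add: X_def)
qed

section \<open>The scalar equation \<open>v * v_t + v_x = 0\<close> for one Riemann
  invariant\<close>

definition carroll_wave ::
    "real \<Rightarrow> (real \<Rightarrow> real \<Rightarrow> real) \<Rightarrow> (real \<times> real \<Rightarrow> real) \<Rightarrow> (real \<times> real \<Rightarrow> real) \<Rightarrow> bool" where
  "carroll_wave T v p q \<longleftrightarrow> C1_partials ({0..<T} \<times> UNIV) v p q \<and>
     (\<forall>t x. 0 < t \<and> t < T \<longrightarrow> v t x * p (t, x) + q (t, x) = 0)"

lemma carroll_wave_forward:
  assumes v: "carroll_wave T v p q" and "v 0 y \<noteq> 0" and "0 \<le> t" "t < T"
  shows "v t (y + t / v 0 y) = v 0 y"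
  using constant_on_characteristic[of T v p q t 0 "v 0 y" y t] assms
  by (auto simp: carroll_wave_def)

text \<open>The value \<open>v t x\<close> alone fixes the slope of the line through
  \<open>(t, x)\<close>, hence its foot; no flow has to be inverted.\<close>

lemma carroll_wave_backward:
  assumes v: "carroll_wave T v p q" and "v t x \<noteq> 0" and "0 \<le> t" "t < T"
  shows "v 0 (x - t / v t x) = v t x"
  using constant_on_characteristic[of T v p q t t "v t x" x 0] assms
  by (auto simp: carroll_wave_def)

text \<open>Go back to the initial line with \<open>v'\<close> and forward again with
  \<open>v\<close>: the common value at the foot makes both characteristics the same line.\<close>

lemma carroll_wave_unique:
  assumes v: "carroll_wave T v p q" and v': "carroll_wave T v' p' q'"
    and init: "v 0 = v' 0" and nz: "\<And>y. v 0 y \<noteq> 0" and "v' t x \<noteq> 0" and "0 \<le> t" "t < T"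
  shows "v t x = v' t x"
  using carroll_wave_backward[OF v' \<open>v' t x \<noteq> 0\<close>] assms(6,7)
    carroll_wave_forward[OF v nz[of "x - t / v' t x"] assms(6,7)] init by simp

text \<open>Differentiate \<open>v(t, y + t / v\<^sub>0(y)) = v\<^sub>0(y)\<close> in \<open>y\<close>.\<close>

lemma carroll_wave_slope:
  assumes v: "carroll_wave T v p q" and nz: "\<And>y. v 0 y \<noteq> 0"
    and d: "(v 0 has_real_derivative d) (at y)" and t: "0 < t" "t < T"
  shows "q (t, y + t / v 0 y) * (1 - t * d / (v 0 y)\<^sup>2) = d"
proof -
  have "((\<lambda>y. y + t / v 0 y) has_real_derivative 1 - t * d / (v 0 y)\<^sup>2) (at y)"
    using d nz by (auto intro!: derivative_eq_intros simp: power2_eq_square)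
  with C1_partials_chain[of T v p q "\<lambda>_. t" y 0] v t
  have "((\<lambda>y. v t (y + t / v 0 y)) has_real_derivative
      q (t, y + t / v 0 y) * (1 - t * d / (v 0 y)\<^sup>2)) (at y)"
    by (fastforce simp: carroll_wave_def)
  moreover have "(\<lambda>y. v t (y + t / v 0 y)) = v 0"
    using carroll_wave_forward[OF v nz] t by auto
  ultimately show ?thesis using d DERIV_unique by metis
qed

text \<open>Otherwise \<open>d > 0\<close> and the factor in \<open>carroll_wave_slope\<close>
  vanishes at some time \<open>s \<le> t\<close>, where that identity would read
  \<open>0 = d\<close>.\<close>

lemma carroll_wave_denominator_pos:
  assumes v: "carroll_wave T v p q" and nz: "\<And>y. v 0 y \<noteq> 0"
    and d: "(v 0 has_real_derivative d) (at y)" and t: "0 \<le> t" "t < T"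
  shows "t * d < (v 0 y)\<^sup>2"
proof (rule ccontr)
  assume "\<not> ?thesis"
  then have ge: "(v 0 y)\<^sup>2 \<le> t * d" by simp
  have sq: "0 < (v 0 y)\<^sup>2" using nz by simp
  with ge t have "0 < d" by (smt (verit) mult_nonneg_nonpos)
  define s where "s = (v 0 y)\<^sup>2 / d"
  have "0 < s" "s \<le> t" using sq ge \<open>0 < d\<close> by (auto simp: s_def field_simps)
  with carroll_wave_slope[OF v nz d, of s] t \<open>0 < d\<close> sq show False
    by (auto simp: s_def)
qed

text \<open>Equality cannot be excluded: \<open>carroll_wave_wave_from\<close> constructs a wave
  under exactly this condition on \<open>T\<close>.\<close>

lemma carroll_wave_lifespan:
  assumes v: "carroll_wave T v p q" and nz: "\<And>y. v 0 y \<noteq> 0"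
    and d: "(v 0 has_real_derivative d) (at y)" and "0 < T"
  shows "T * d \<le> (v 0 y)\<^sup>2"
proof (rule ccontr)
  assume *: "\<not> ?thesis"
  then have "0 < d" using \<open>0 < T\<close> by (smt (verit) mult_nonneg_nonpos zero_le_power2)
  have "0 < (v 0 y)\<^sup>2" using nz by simp
  then have "0 \<le> (v 0 y)\<^sup>2 / d" "(v 0 y)\<^sup>2 / d < T" using * \<open>0 < d\<close> by (auto simp: field_simps)
  from carroll_wave_denominator_pos[OF v nz d this] \<open>0 < d\<close> show False by simp
qed

text \<open>With \<open>e\<close> the positive factor in \<open>carroll_wave_slope\<close>,
  \<open>d = (1 - e) * (v 0 y)\<^sup>2 / t\<close>, so \<open>q * e = d\<close> gives
  \<open>q = (1 / e - 1) * (v 0 y)\<^sup>2 / t\<close>. Dropping \<open>1 / e > 0\<close> leaves a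
  bound free of the slope of the data.\<close>

lemma carroll_wave_one_sided_bound:
  assumes v: "carroll_wave T v p q" and nz: "\<And>y. v 0 y \<noteq> 0" and nz': "v t x \<noteq> 0"
    and diff: "\<And>y. v 0 differentiable at y" and t: "0 < t" "t < T"
  shows "\<exists>y. - ((v 0 y)\<^sup>2 / t) \<le> deriv (v t) x"
proof
  define y where "y = x - t / v t x"
  have vy: "v 0 y = v t x"
    using carroll_wave_backward[OF v nz'] t by (simp add: y_def)
  then have xy: "y + t / v 0 y = x" by (simp add: y_def)
  define d where "d = deriv (v 0) y"
  have d: "(v 0 has_real_derivative d) (at y)"
    using diff[of y] by (simp add: d_def DERIV_deriv_iff_real_differentiable)
  define e where "e = 1 - t * d / (v 0 y)\<^sup>2"
  have sq: "0 < (v 0 y)\<^sup>2" using nz by simp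
  have e: "0 < e"
    using carroll_wave_denominator_pos[OF v nz d, of t] t sq by (simp add: e_def)
  have eq: "q (t, x) * e = d"
    using carroll_wave_slope[OF v nz d t] by (simp add: xy e_def)
  have "- ((v 0 y)\<^sup>2 / t) * e = d - (v 0 y)\<^sup>2 / t"
    using t nz[of y] by (simp add: e_def field_simps)
  also have "\<dots> \<le> q (t, x) * e" using eq sq t by simp
  finally have "- ((v 0 y)\<^sup>2 / t) \<le> q (t, x)" using e mult_le_cancel_right_pos by blast
  moreover have "deriv (v t) x = q (t, x)"
    using C1_partials_chain[of T v p q "\<lambda>_. t" x 0 "\<lambda>x. x" 1] v t
    by (intro DERIV_imp_deriv) (auto simp: carroll_wave_def)
  ultimately show "- ((v 0 y)\<^sup>2 / t) \<le> deriv (v t) x" by simp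
qed

section \<open>Exclusion of vacuum\<close>

text \<open>The invariants have to be handled together, since the equation of either is available
  only where \<open>z < w\<close>. Over all of space an earliest bad time need not be attained;
  inside a cone it is, and the characteristics traced back from there stay in the cone.\<close>

lemma carroll_wave_no_vacuum:
  assumes w: "C1_partials ({0..<T} \<times> UNIV) w p q" and z: "C1_partials ({0..<T} \<times> UNIV) z p' q'"
    and eq: "\<And>t x. 0 < t \<Longrightarrow> t < T \<Longrightarrow> z t x < w t x \<Longrightarrow>
      w t x * p (t, x) + q (t, x) = 0 \<and> z t x * p' (t, x) + q' (t, x) = 0"
    and "0 < c" and w0: "\<And>x. c \<le> w 0 x" and z0: "\<And>x. z 0 x \<le> - c"
    and t: "0 \<le> t" "t < T"
  shows "z t x < 0 \<and> 0 < w t x"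
proof -
  \<comment> \<open>Any number strictly between 0 and \<open>c\<close> would do:
    \<open>b > 0\<close> keeps the speeds finite, and \<open>b < c\<close> makes the gap
    \<open>c\<close> recovered on the initial line contradict badness at the apex.\<close>
  define b where "b = c / 2"
  have b: "0 < b" "b < c" using \<open>0 < c\<close> by (auto simp: b_def)
  define f where "f = (\<lambda>(t, x). min (w t x) (- z t x))"
  have contf: "continuous_on ({0..<T} \<times> UNIV) f"
    using C1_partials_continuous[OF w] C1_partials_continuous[OF z]
    unfolding f_def case_prod_unfold by (intro continuous_intros)
  have "b < f (t, x)"
  proof (rule ccontr)
    assume bad: "\<not> ?thesis"
    \<comment> \<open>The backward cone with apex \<open>(t, x)\<close>. Its sides move at
      \<open>1 / b\<close>, the largest speed of a line whose invariant has modulus at least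
      \<open>b\<close>; the rectangle makes compactness immediate.\<close>
    define K where "K = ({0..t} \<times> {x - t / b..x + t / b}) \<inter>
      {y. \<bar>snd y - x\<bar> \<le> (t - fst y) / b}"
    have K: "(s, y) \<in> K \<longleftrightarrow> 0 \<le> s \<and> s \<le> t \<and> \<bar>y - x\<bar> \<le> (t - s) / b" for s y
      using b unfolding K_def by (auto simp: field_simps abs_le_iff)
    have "compact K"
      unfolding K_def using b
      by (intro compact_Int_closed compact_Times compact_Icc closed_Collect_le continuous_intros) auto
    have "K \<subseteq> {0..<T} \<times> UNIV" using K t by auto
    define B where "B = K \<inter> f -` {..b}"
    have "closed B"
      unfolding B_def using \<open>compact K\<close> \<open>K \<subseteq> _\<close>
      by (intro continuous_closed_preimage continuous_on_subset[OF contf]) (auto simp: compact_imp_closed)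
    then have "compact (K \<inter> B)" using \<open>compact K\<close> by (rule compact_Int_closed[rotated])
    moreover have "K \<inter> B = B" by (auto simp: B_def)
    ultimately have "compact B" by simp
    moreover have "(t, x) \<in> B" using bad t b by (simp add: B_def K)
    ultimately obtain y where y: "y \<in> B" and min: "\<And>r. r \<in> B \<Longrightarrow> fst y \<le> fst r"
      using continuous_attains_inf[of B fst] continuous_on_fst[OF continuous_on_id] by blast
    define s x\<^sub>1 where "s = fst y" and "x\<^sub>1 = snd y"
    have sK: "(s, x\<^sub>1) \<in> K" and sbad: "f (s, x\<^sub>1) \<le> b" using y by (auto simp: B_def s_def x\<^sub>1_def)
    have s: "0 \<le> s" "s \<le> t" "s < T" using sK K t by auto
    have "f (0, x\<^sub>1) \<ge> c" using w0[of x\<^sub>1] z0[of x\<^sub>1] by (auto simp: f_def)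
    with sbad b have "s \<noteq> 0" by auto
    with s have "0 < s" by simp
    \<comment> \<open>The cone below \<open>(s, x\<^sub>1)\<close> lies in \<open>K\<close> by the
      triangle inequality, and minimality of \<open>s\<close> keeps its earlier points out of
      \<open>B\<close>.\<close>
    have good: "b < w r y \<and> z r y < - b" if "0 \<le> r" "r < s" "\<bar>y - x\<^sub>1\<bar> \<le> (s - r) / b" for r y
    proof -
      have "\<bar>y - x\<bar> \<le> (s - r) / b + (t - s) / b"
        using that sK K[of s x\<^sub>1] by linarith
      then have "(r, y) \<in> K" using that s by (simp add: K diff_divide_distrib)
      moreover have "(r, y) \<notin> B" using min[of "(r, y)"] that by (auto simp: s_def)
      ultimately show ?thesis by (auto simp: B_def f_def)
    qed
    \<comment> \<open>At the apex itself, which is bad, only the limits of the strict bounds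
      survive. They still give modulus at least \<open>b\<close>, which is what the slopes of the
      two lines require.\<close>
    have clos: "closure {0..<s} = {0..s}" using \<open>0 < s\<close> by simp
    have "b \<le> w s x\<^sub>1"
    proof (rule continuous_ge_on_closure[where S = "{0..<s}" and f = "\<lambda>r. w r x\<^sub>1"])
      show "continuous_on (closure {0..<s}) (\<lambda>r. w r x\<^sub>1)"
        unfolding clos using s by (intro C1_partials_continuous_curve[OF w]) auto
    qed (use clos s good b in \<open>auto intro: less_imp_le\<close>)
    moreover have "- b \<ge> z s x\<^sub>1"
    proof (rule continuous_le_on_closure[where S = "{0..<s}" and f = "\<lambda>r. z r x\<^sub>1"])
      show "continuous_on (closure {0..<s}) (\<lambda>r. z r x\<^sub>1)"
        unfolding clos using s by (intro C1_partials_continuous_curve[OF z]) auto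
    qed (use clos s good b in \<open>auto intro: less_imp_le\<close>)
    ultimately have bw: "b \<le> w s x\<^sub>1" and bz: "z s x\<^sub>1 \<le> - b" by auto
    \<comment> \<open>Both lines traced back from the apex stay in the cone where
      \<open>z < w\<close>, so the equations hold along them.\<close>
    have near: "\<bar>(r - s) / m\<bar> \<le> (s - r) / b" if "r < s" "b \<le> \<bar>m\<bar>" for r m
      using that b by (simp add: abs_divide frac_le)
    have "w 0 (x\<^sub>1 + (0 - s) / w s x\<^sub>1) = w s x\<^sub>1"
    proof (rule constant_on_characteristic[OF w s(3)])
      fix r assume r: "0 < r" "r < s"
      have "z r (x\<^sub>1 + (r - s) / w s x\<^sub>1) < w r (x\<^sub>1 + (r - s) / w s x\<^sub>1)"
        using good[of r "x\<^sub>1 + (r - s) / w s x\<^sub>1"] near[of r "w s x\<^sub>1"] r bw b by fastforce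
      then show "w r (x\<^sub>1 + (r - s) / w s x\<^sub>1) * p (r, x\<^sub>1 + (r - s) / w s x\<^sub>1)
          + q (r, x\<^sub>1 + (r - s) / w s x\<^sub>1) = 0"
        using eq r s by auto
    qed (use s bw b in auto)
    moreover have "z 0 (x\<^sub>1 + (0 - s) / z s x\<^sub>1) = z s x\<^sub>1"
    proof (rule constant_on_characteristic[OF z s(3)])
      fix r assume r: "0 < r" "r < s"
      have "z r (x\<^sub>1 + (r - s) / z s x\<^sub>1) < w r (x\<^sub>1 + (r - s) / z s x\<^sub>1)"
        using good[of r "x\<^sub>1 + (r - s) / z s x\<^sub>1"] near[of r "z s x\<^sub>1"] r bz b by fastforce
      then show "z r (x\<^sub>1 + (r - s) / z s x\<^sub>1) * p' (r, x\<^sub>1 + (r - s) / z s x\<^sub>1)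
          + q' (r, x\<^sub>1 + (r - s) / z s x\<^sub>1) = 0"
        using eq r s by auto
    qed (use s bz b in auto)
    ultimately have "c \<le> w s x\<^sub>1" "z s x\<^sub>1 \<le> - c" using w0 z0 by metis+
    with sbad b show False by (auto simp: f_def)
  qed
  with b show ?thesis by (auto simp: f_def)
qed

section \<open>Construction of a wave by inverting the characteristic map\<close>

text \<open>Caratheodory's criterion in two variables: an exact factorization of the increment
  replaces remainder estimates, so the coefficients may involve the function being differentiated,
  as they do for \<open>foot\<close>.\<close>

lemma has_derivative_difference_quotients:
  fixes f :: "real \<times> real \<Rightarrow> real"
  assumes eq: "\<forall>\<^sub>F y in at z within S. f y - f z = P y * (fst y - fst z) + Q y * (snd y - snd z)"
    and P: "(P \<longlongrightarrow> p) (at z within S)" and Q: "(Q \<longlongrightarrow> q) (at z within S)"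
  shows "(f has_derivative (\<lambda>h. p * fst h + q * snd h)) (at z within S)"
  unfolding has_derivative_within
proof
  show "bounded_linear (\<lambda>h :: real \<times> real. p * fst h + q * snd h)"
    by (intro bounded_linear_add bounded_linear_const_mult bounded_linear_fst bounded_linear_snd)
  have "((\<lambda>y. \<bar>P y - p\<bar> + \<bar>Q y - q\<bar>) \<longlongrightarrow> \<bar>p - p\<bar> + \<bar>q - q\<bar>) (at z within S)"
    by (intro tendsto_intros P Q)
  then have lim: "((\<lambda>y. \<bar>P y - p\<bar> + \<bar>Q y - q\<bar>) \<longlongrightarrow> 0) (at z within S)" by simp
  show "((\<lambda>y. (1 / norm (y - z)) *\<^sub>R (f y - (f z + (p * fst (y - z) + q * snd (y - z))))) \<longlongrightarrow> 0)
      (at z within S)"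
  proof (rule Lim_null_comparison[OF _ lim], use eq in eventually_elim)
    fix y assume y: "f y - f z = P y * (fst y - fst z) + Q y * (snd y - snd z)"
    have "f y - (f z + (p * fst (y - z) + q * snd (y - z))) =
        (P y - p) * fst (y - z) + (Q y - q) * snd (y - z)"
      using y by (simp add: algebra_simps)
    also have "\<bar>\<dots>\<bar> \<le> \<bar>P y - p\<bar> * \<bar>fst (y - z)\<bar> + \<bar>Q y - q\<bar> * \<bar>snd (y - z)\<bar>"
      using abs_triangle_ineq by (simp add: abs_mult[symmetric])
    also have "\<dots> \<le> \<bar>P y - p\<bar> * norm (y - z) + \<bar>Q y - q\<bar> * norm (y - z)"
      using norm_fst_le[of "fst (y - z)" "snd (y - z)", unfolded prod.collapse]
        norm_snd_le[of "snd (y - z)" "fst (y - z)", unfolded prod.collapse]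
      by (intro add_mono mult_left_mono) auto
    finally show "norm ((1 / norm (y - z)) *\<^sub>R (f y - (f z + (p * fst (y - z) + q * snd (y - z)))))
        \<le> \<bar>P y - p\<bar> + \<bar>Q y - q\<bar>"
      by (cases "y = z") (auto simp: divide_simps distrib_right abs_mult)
  qed
qed

text \<open>The point at time 0 of the characteristic of speed \<open>u\<close> through
  \<open>(t, x)\<close>. The description is meaningful while \<open>y + t * u y\<close> is a
  bijection of the line.\<close>

definition foot :: "(real \<Rightarrow> real) \<Rightarrow> real \<Rightarrow> real \<Rightarrow> real" where
  "foot u t x = (THE y. y + t * u y = x)"

context
  fixes u u' :: "real \<Rightarrow> real" and C T :: real
  assumes du: "\<And>y. (u has_real_derivative u' y) (at y)" and cont_u': "continuous_on UNIV u'"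
    and bound: "\<And>y. \<bar>u y\<bar> \<le> C"
    and pos: "\<And>t y. 0 \<le> t \<Longrightarrow> t < T \<Longrightarrow> 0 < 1 + t * u' y"
begin

lemma strict_mono_foot:
  assumes t: "0 \<le> t" "t < T"
  shows "strict_mono (\<lambda>y. y + t * u y)"
proof (rule strict_monoI)
  fix a b :: real assume "a < b"
  then show "a + t * u a < b + t * u b"
  proof (rule DERIV_pos_imp_increasing)
    fix y
    have "((\<lambda>y. y + t * u y) has_real_derivative 1 + t * u' y) (at y)"
      by (auto intro!: derivative_eq_intros du)
    with pos[OF t, of y] show "\<exists>d. ((\<lambda>y. y + t * u y) has_real_derivative d) (at y) \<and> 0 < d" by blast
  qed
qed

lemma isCont_u: "isCont u y"
  using du DERIV_isCont by blast

lemma foot_eq: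
  assumes t: "0 \<le> t" "t < T"
  shows "foot u t x + t * u (foot u t x) = x"
proof -
  \<comment> \<open>A speed of modulus at most \<open>C\<close> moves a point by at most
    \<open>t * C\<close>, which locates the foot.\<close>
  have "\<exists>y\<ge>x - t * C. y \<le> x + t * C \<and> y + t * u y = x"
  proof (rule IVT)
    have *: "t * u y \<le> t * C \<and> - (t * C) \<le> t * u y" for y
      using bound[of y] t mult_left_mono[of "u y" C t] mult_left_mono[of "- C" "u y" t] by auto
    show "x - t * C + t * u (x - t * C) \<le> x" "x \<le> x + t * C + t * u (x + t * C)"
      using *[of "x - t * C"] *[of "x + t * C"] by auto
    have "0 \<le> C" using bound[of 0] by linarith
    then show "x - t * C \<le> x + t * C" using t by (simp add: add_increasing2)
    show "\<forall>y. x - t * C \<le> y \<and> y \<le> x + t * C \<longrightarrow> isCont (\<lambda>y. y + t * u y) y"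
      by (intro allI impI continuous_intros isCont_u)
  qed
  then obtain y where y: "y + t * u y = x" by blast
  show ?thesis
    unfolding foot_def
    by (rule theI[where a = y]) (use y strict_mono_eq[OF strict_mono_foot[OF t]] in auto)
qed

lemma less_foot_iff:
  assumes t: "0 \<le> t" "t < T"
  shows "a < foot u t x \<longleftrightarrow> a + t * u a < x" and "foot u t x < a \<longleftrightarrow> x < a + t * u a"
  using strict_mono_less[OF strict_mono_foot[OF t], of a "foot u t x"]
    strict_mono_less[OF strict_mono_foot[OF t], of "foot u t x" a] foot_eq[OF t, of x] by auto

text \<open>By \<open>less_foot_iff\<close>, comparing \<open>foot\<close> with a fixed
  \<open>a\<close> is an affine inequality in \<open>(t, x)\<close>, hence an open condition in the
  strip; this also covers the boundary \<open>t = 0\<close>.\<close>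

lemma tendsto_foot:
  assumes z: "z \<in> {0..<T} \<times> UNIV"
  shows "((\<lambda>(t, x). foot u t x) \<longlongrightarrow> foot u (fst z) (snd z)) (at z within {0..<T} \<times> UNIV)"
proof (rule order_tendstoI)
  have in_S: "\<forall>\<^sub>F y in at z within {0..<T} \<times> UNIV. y \<in> {0..<T} \<times> UNIV"
    by (simp add: eventually_at_filter)
  fix a
  have lim: "((\<lambda>y. snd y - (a + fst y * u a)) \<longlongrightarrow> snd z - (a + fst z * u a))
      (at z within {0..<T} \<times> UNIV)"
    by (intro tendsto_intros)
  show "\<forall>\<^sub>F y in at z within {0..<T} \<times> UNIV. a < (case y of (t, x) \<Rightarrow> foot u t x)"
    if "a < foot u (fst z) (snd z)"
    using in_S order_tendstoD(1)[OF lim, of 0] less_foot_iff(1)[of "fst z" a "snd z"] that z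
    by (auto elim!: eventually_elim2 simp: less_foot_iff)
  show "\<forall>\<^sub>F y in at z within {0..<T} \<times> UNIV. (case y of (t, x) \<Rightarrow> foot u t x) < a"
    if "foot u (fst z) (snd z) < a"
    using in_S order_tendstoD(2)[OF lim, of 0] less_foot_iff(2)[of "fst z" "snd z" a] that z
    by (auto elim!: eventually_elim2 simp: less_foot_iff)
qed

text \<open>Implicit differentiation of \<open>y + t * u y = x\<close>. With the Caratheodory slope
  \<open>g\<close> of \<open>u\<close> it becomes an exact division by \<open>1 + t * g\<close>,
  which is positive nearby; this works up to the boundary \<open>t = 0\<close>.\<close>

lemma C1_partials_foot:
  "C1_partials ({0..<T} \<times> UNIV) (foot u)
     (\<lambda>(t, x). - u (foot u t x) / (1 + t * u' (foot u t x)))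
     (\<lambda>(t, x). 1 / (1 + t * u' (foot u t x)))"
  unfolding C1_partials_def
proof (intro conjI ballI)
  let ?S = "{0..<T} \<times> (UNIV :: real set)" and ?f = "\<lambda>(t, x). foot u t x"
  have cont: "continuous_on ?S ?f"
    unfolding continuous_on using tendsto_foot by (auto simp: case_prod_unfold)
  have cont_u: "continuous_on UNIV u"
    using isCont_u by (simp add: continuous_at_imp_continuous_on)
  have cont': "continuous_on ?S (\<lambda>z. u (?f z))" "continuous_on ?S (\<lambda>z. u' (?f z))"
    by (auto intro!: continuous_on_compose2[OF cont_u cont] continuous_on_compose2[OF cont_u' cont])
  have nz: "1 + fst z * u' (?f z) \<noteq> 0" if "z \<in> ?S" for z
    using pos[of "fst z" "?f z"] that by auto
  show "continuous_on ?S (\<lambda>(t, x). - u (foot u t x) / (1 + t * u' (foot u t x)))"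
    "continuous_on ?S (\<lambda>(t, x). 1 / (1 + t * u' (foot u t x)))"
    using cont' nz unfolding case_prod_unfold by (auto intro!: continuous_intros)
  fix z assume z: "z \<in> ?S"
  define t y where "t = fst z" and "y = ?f z"
  have t: "0 \<le> t" "t < T" using z by (auto simp: t_def)
  obtain g where g: "\<And>w. u w - u y = g w * (w - y)" "isCont g y" "g y = u' y"
    using du[of y] unfolding CARAT_DERIV by blast
  have lim: "(?f \<longlongrightarrow> y) (at z within ?S)"
    using tendsto_foot[OF z] by (simp add: y_def case_prod_unfold)
  have limg: "((\<lambda>r. g (?f r)) \<longlongrightarrow> u' y) (at z within ?S)"
    using isCont_tendsto_compose[OF g(2) lim] g(3) by simp
  have limu: "((\<lambda>r. u (?f r)) \<longlongrightarrow> u y) (at z within ?S)"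
    using isCont_tendsto_compose[OF isCont_u lim] .
  have limd: "((\<lambda>r. 1 + t * g (?f r)) \<longlongrightarrow> 1 + t * u' y) (at z within ?S)"
    by (intro tendsto_intros limg)
  have "(?f has_derivative (\<lambda>h. - u y / (1 + t * u' y) * fst h + 1 / (1 + t * u' y) * snd h))
      (at z within ?S)"
  \<comment> \<open>Subtracting the foot equations at \<open>r\<close> and \<open>z\<close>, split
    \<open>fst r * u (?f r) - t * u y\<close> into \<open>(fst r - t) * u (?f r)\<close> and
    \<open>t * (u (?f r) - u y)\<close>. Hence the numerator has \<open>u\<close> at the moving foot
    and the denominator the fixed time \<open>t\<close>.\<close>
  proof (rule has_derivative_difference_quotients[where
        P = "\<lambda>r. - u (?f r) / (1 + t * g (?f r))" and Q = "\<lambda>r. 1 / (1 + t * g (?f r))"])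
    show "((\<lambda>r. - u (?f r) / (1 + t * g (?f r))) \<longlongrightarrow> - u y / (1 + t * u' y)) (at z within ?S)"
      "((\<lambda>r. 1 / (1 + t * g (?f r))) \<longlongrightarrow> 1 / (1 + t * u' y)) (at z within ?S)"
      using pos[OF t, of y] by (auto intro!: tendsto_intros limd limu)
    have "\<forall>\<^sub>F r in at z within ?S. r \<in> ?S"
      by (simp add: eventually_at_filter)
    moreover have "\<forall>\<^sub>F r in at z within ?S. 0 < 1 + t * g (?f r)"
      using order_tendstoD(1)[OF limd pos[OF t]] .
    ultimately show "\<forall>\<^sub>F r in at z within ?S. ?f r - ?f z =
        - u (?f r) / (1 + t * g (?f r)) * (fst r - fst z) + 1 / (1 + t * g (?f r)) * (snd r - snd z)"
    proof eventually_elim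
      case (elim r)
      have "?f r + fst r * u (?f r) = snd r" "y + t * u y = snd z"
        using foot_eq[of "fst r" "snd r"] foot_eq[of t "snd z"] elim t
        by (auto simp: y_def t_def case_prod_unfold)
      moreover have "u (?f r) = u y + g (?f r) * (?f r - y)" using g(1)[of "?f r"] by simp
      moreover have "(Y - y) * (1 + t * G) = - U * (fst r - t) + (snd r - snd z)"
        if "Y + fst r * U = snd r" "y + t * u y = snd z" "U = u y + G * (Y - y)" for Y U G
      proof -
        have "(Y - y) * (1 + t * G) = Y - y + t * (G * (Y - y))" by (simp add: algebra_simps)
        also have "G * (Y - y) = U - u y" using that(3) by simp
        finally show ?thesis using that(1,2)[symmetric] by (simp add: algebra_simps)
      qed
      ultimately have "(?f r - y) * (1 + t * g (?f r)) =
          - u (?f r) * (fst r - t) + (snd r - snd z)"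
        by blast
      then have "?f r - y = (- u (?f r) * (fst r - t) + (snd r - snd z)) / (1 + t * g (?f r))"
        using elim by (simp add: eq_divide_eq)
      then show ?case by (simp add: y_def t_def diff_divide_distrib)
    qed
  qed
  then show "(?f has_derivative
      (\<lambda>h. (case z of (t, x) \<Rightarrow> - u (foot u t x) / (1 + t * u' (foot u t x))) * fst h +
           (case z of (t, x) \<Rightarrow> 1 / (1 + t * u' (foot u t x))) * snd h)) (at z within ?S)"
    by (simp add: y_def t_def case_prod_unfold)
qed

end

definition wave_from :: "(real \<Rightarrow> real) \<Rightarrow> real \<Rightarrow> real \<Rightarrow> real" where
  "wave_from f t x = f (foot (\<lambda>y. 1 / f y) t x)"

lemma wave_from_0: "wave_from f 0 = f"
  by (auto simp: wave_from_def foot_def)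

text \<open>For the speed \<open>u = 1 / f\<close> one has \<open>u' = - d / f\<^sup>2\<close>, so
  the condition on \<open>T\<close> is what makes the characteristic map strictly increasing before
  \<open>T\<close>, and \<open>c\<close> bounds the speed by \<open>1 / c\<close>.\<close>

lemma carroll_wave_wave_from:
  assumes df: "\<And>y. (f has_real_derivative d y) (at y)" and d: "continuous_on UNIV d"
    and c: "0 < c" "\<And>y. c \<le> \<bar>f y\<bar>" and T: "\<And>y. T * d y \<le> (f y)\<^sup>2"
  shows "\<exists>p q. carroll_wave T (wave_from f) p q"
proof -
  let ?S = "{0..<T} \<times> (UNIV :: real set)"
  define u where "u = (\<lambda>y. 1 / f y)"
  define u' where "u' = (\<lambda>y. - d y / (f y)\<^sup>2)"
  have nz: "f y \<noteq> 0" for y using c(1) c(2)[of y] by auto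
  have cont: "continuous_on UNIV f"
    using df DERIV_isCont continuous_at_imp_continuous_on by blast
  have pos: "0 < 1 + t * u' y" if "0 \<le> t" "t < T" for t y
  proof -
    have sq: "0 < (f y)\<^sup>2" using nz by simp
    \<comment> \<open>Strict although the bound at \<open>T\<close> is not: where
      \<open>d y > 0\<close> strictness comes from \<open>t < T\<close>, elsewhere from
      \<open>f y\<close> being nonzero.\<close>
    have "t * d y < (f y)\<^sup>2"
    proof (cases "0 < d y")
      case True
      then have "t * d y < T * d y" using that by simp
      then show ?thesis using T[of y] by simp
    next
      case False
      then have "t * d y \<le> 0" using that by (simp add: mult_nonneg_nonpos)
      then show ?thesis using sq by linarith
    qed
    then show ?thesis using sq by (simp add: u'_def field_simps)
  qed
  have foot: "C1_partials ?S (foot u) (\<lambda>(t, x). - u (foot u t x) / (1 + t * u' (foot u t x)))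
     (\<lambda>(t, x). 1 / (1 + t * u' (foot u t x)))" (is "C1_partials _ _ ?p ?q")
  proof (rule C1_partials_foot[of u u' "1 / c"])
    show "(u has_real_derivative u' y) (at y)" for y
      unfolding u_def u'_def using nz[of y]
      by (auto intro!: derivative_eq_intros df simp: power2_eq_square)
    show "continuous_on UNIV u'"
      unfolding u'_def using nz by (auto intro!: continuous_intros d cont)
    show "\<bar>u y\<bar> \<le> 1 / c" for y
      unfolding u_def using c(1) c(2)[of y] by (simp add: abs_divide frac_le)
  qed (rule pos)
  let ?f = "\<lambda>(t, x). foot u t x"
  have "C1_partials ?S (wave_from f) (\<lambda>z. d (?f z) * ?p z) (\<lambda>z. d (?f z) * ?q z)"
    unfolding C1_partials_def
  proof (intro conjI ballI)
    have "continuous_on ?S (\<lambda>z. d (?f z))"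
      using C1_partials_continuous[OF foot] by (intro continuous_on_compose2[OF d]) auto
    then show "continuous_on ?S (\<lambda>z. d (?f z) * ?p z)" "continuous_on ?S (\<lambda>z. d (?f z) * ?q z)"
      using foot unfolding C1_partials_def by (auto intro!: continuous_on_mult)
    fix z assume "z \<in> ?S"
    then have "(?f has_derivative (\<lambda>h. ?p z * fst h + ?q z * snd h)) (at z within ?S)"
      using foot unfolding C1_partials_def by blast
    from has_derivative_compose[OF this df[unfolded has_field_derivative_def]]
    show "((\<lambda>(t, x). wave_from f t x) has_derivative
        (\<lambda>h. d (?f z) * ?p z * fst h + d (?f z) * ?q z * snd h)) (at z within ?S)"
      by (simp add: wave_from_def u_def case_prod_unfold algebra_simps)
  qed
  moreover have "wave_from f t x * (d (foot u t x) * ?p (t, x)) + d (foot u t x) * ?q (t, x) = 0" for t x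
    using nz[of "foot u t x"] by (simp add: wave_from_def u_def)
  ultimately show ?thesis
    unfolding carroll_wave_def by (intro exI conjI) auto
qed

section \<open>Passage between the fluid equations and the Riemann invariants\<close>

lemma conservation_law_at_unique:
  assumes "conservation_law_at q f t x" and "((\<lambda>s. q s x) has_real_derivative a) (at t)"
    and "(f t has_real_derivative b) (at x)"
  shows "a + b = 0"
proof -
  obtain a' b' where "((\<lambda>s. q s x) has_real_derivative a') (at t)"
    "(f t has_real_derivative b') (at x)" "a' + b' = 0"
    using assms(1) unfolding conservation_law_at_def by blast
  with assms(2,3) show ?thesis using DERIV_unique by blast
qed

text \<open>Subtracting \<open>\<beta>\<close> times the first law from the second leaves a multiple
  of \<open>\<sigma>\<close>, which can be cancelled only where \<open>\<sigma> > 0\<close>. The sum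
  and the difference of the result and the first law are the two equations.\<close>

lemma C1_solution_Riemann:
  assumes sol: "C1_solution 3 T \<sigma> \<beta>"
  obtains p q p' q' where
    "C1_partials ({0..<T} \<times> UNIV) (\<lambda>t x. \<beta> t x + \<sigma> t x) p q"
    "C1_partials ({0..<T} \<times> UNIV) (\<lambda>t x. \<beta> t x - \<sigma> t x) p' q'"
    "\<And>t x. 0 < t \<Longrightarrow> t < T \<Longrightarrow> 0 < \<sigma> t x \<Longrightarrow>
       (\<beta> t x + \<sigma> t x) * p (t, x) + q (t, x) = 0 \<and> (\<beta> t x - \<sigma> t x) * p' (t, x) + q' (t, x) = 0"
proof -
  obtain p1 q1 p2 q2 where b: "C1_partials ({0..<T} \<times> UNIV) \<beta> p1 q1"
    and s: "C1_partials ({0..<T} \<times> UNIV) \<sigma> p2 q2"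
    using sol unfolding C1_solution_def C1_on_iff_partials by blast
  show thesis
  proof (rule that)
    show "C1_partials ({0..<T} \<times> UNIV) (\<lambda>t x. \<beta> t x + \<sigma> t x) (\<lambda>z. p1 z + p2 z) (\<lambda>z. q1 z + q2 z)"
      using C1_partials_linear[OF b s, of 1 1] by simp
    show "C1_partials ({0..<T} \<times> UNIV) (\<lambda>t x. \<beta> t x - \<sigma> t x) (\<lambda>z. p1 z - p2 z) (\<lambda>z. q1 z - q2 z)"
      using C1_partials_linear[OF b s, of 1 "-1"] by simp
    fix t x assume t: "0 < t" "t < T" and pos: "0 < \<sigma> t x"
    note [derivative_intros] =
      C1_partials_chain[OF b t DERIV_const DERIV_ident, of x, simplified]
      C1_partials_chain[OF s t DERIV_const DERIV_ident, of x, simplified]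
      C1_partials_chain[OF b _ _ DERIV_ident DERIV_const, of t x, OF t, simplified]
      C1_partials_chain[OF s _ _ DERIV_ident DERIV_const, of t x, OF t, simplified]
    have eqs: "carroll_equations_at 3 \<sigma> \<beta> t x" using sol t by (auto simp: C1_solution_def)
    have d1: "((\<lambda>s. \<sigma> s x * \<beta> s x) has_real_derivative
        p2 (t, x) * \<beta> t x + p1 (t, x) * \<sigma> t x) (at t)"
      by (auto intro!: derivative_eq_intros)
    have d2: "(\<sigma> t has_real_derivative q2 (t, x)) (at x)"
      by (auto intro!: derivative_eq_intros)
    have dp: "((\<lambda>s. \<sigma> s x powr 3) has_real_derivative 3 * \<sigma> t x powr (3 - 1) * p2 (t, x)) (at t)"
      using pos by (intro DERIV_chain2[OF has_real_derivative_powr]) (auto intro!: derivative_intros)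
    have d3: "((\<lambda>s. inverse 3 * \<sigma> s x powr 3 + \<sigma> s x * (\<beta> s x)\<^sup>2) has_real_derivative
        (\<sigma> t x)\<^sup>2 * p2 (t, x) + (p2 (t, x) * (\<beta> t x)\<^sup>2 + 2 * \<beta> t x * p1 (t, x) * \<sigma> t x)) (at t)"
      using pos by (auto intro!: derivative_eq_intros dp)
    have d4: "((\<lambda>y. \<sigma> t y * \<beta> t y) has_real_derivative
        q2 (t, x) * \<beta> t x + q1 (t, x) * \<sigma> t x) (at x)"
      by (auto intro!: derivative_eq_intros)
    have e1: "p2 (t, x) * \<beta> t x + p1 (t, x) * \<sigma> t x + q2 (t, x) = 0"
      using conservation_law_at_unique[OF conjunct1[OF eqs[unfolded carroll_equations_at_def]] d1 d2] .
    have "(\<sigma> t x)\<^sup>2 * p2 (t, x) + (p2 (t, x) * (\<beta> t x)\<^sup>2 + 2 * \<beta> t x * p1 (t, x) * \<sigma> t x) +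
        (q2 (t, x) * \<beta> t x + q1 (t, x) * \<sigma> t x) = 0"
      using conservation_law_at_unique[OF conjunct2[OF eqs[unfolded carroll_equations_at_def]] d3 d4] .
    then have "\<sigma> t x * (\<sigma> t x * p2 (t, x) + \<beta> t x * p1 (t, x) + q1 (t, x)) = 0"
      using e1 by algebra
    with pos have "\<sigma> t x * p2 (t, x) + \<beta> t x * p1 (t, x) + q1 (t, x) = 0" by simp
    with e1 show "(\<beta> t x + \<sigma> t x) * (p1 (t, x) + p2 (t, x)) + (q1 (t, x) + q2 (t, x)) = 0 \<and>
        (\<beta> t x - \<sigma> t x) * (p1 (t, x) - p2 (t, x)) + (q1 (t, x) - q2 (t, x)) = 0"
      by algebra
  qed
qed

text \<open>Breaks the circle: as \<open>w - z\<close> is twice \<open>\<sigma>\<close>, the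
  equations known where \<open>\<sigma> > 0\<close> are just what
  \<open>carroll_wave_no_vacuum\<close> asks for, and its conclusion makes them
  unconditional.\<close>

lemma C1_solution_waves:
  assumes sol: "C1_solution 3 T \<sigma> \<beta>" and "0 < c" and init: "\<And>x. c \<le> \<sigma> 0 x - \<bar>\<beta> 0 x\<bar>"
  obtains p q p' q' where "carroll_wave T (\<lambda>t x. \<beta> t x + \<sigma> t x) p q"
    "carroll_wave T (\<lambda>t x. \<beta> t x - \<sigma> t x) p' q'"
    "\<And>t x. 0 \<le> t \<Longrightarrow> t < T \<Longrightarrow> \<beta> t x - \<sigma> t x < 0 \<and> 0 < \<beta> t x + \<sigma> t x"
proof -
  obtain p q p' q' where
    w: "C1_partials ({0..<T} \<times> UNIV) (\<lambda>t x. \<beta> t x + \<sigma> t x) p q" and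
    z: "C1_partials ({0..<T} \<times> UNIV) (\<lambda>t x. \<beta> t x - \<sigma> t x) p' q'" and
    eq: "\<And>t x. 0 < t \<Longrightarrow> t < T \<Longrightarrow> 0 < \<sigma> t x \<Longrightarrow>
       (\<beta> t x + \<sigma> t x) * p (t, x) + q (t, x) = 0 \<and> (\<beta> t x - \<sigma> t x) * p' (t, x) + q' (t, x) = 0"
    using C1_solution_Riemann[OF sol] by blast
  have signs: "\<beta> t x - \<sigma> t x < 0 \<and> 0 < \<beta> t x + \<sigma> t x" if "0 \<le> t" "t < T" for t x
  proof (rule carroll_wave_no_vacuum[OF w z _ \<open>0 < c\<close> _ _ that])
    show "c \<le> \<beta> 0 x + \<sigma> 0 x" "\<beta> 0 x - \<sigma> 0 x \<le> - c" for x
      using init[of x] by auto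
  qed (use eq in auto)
  have "0 < \<sigma> t x" if "0 < t" "t < T" for t x
    using signs[of t x] that by linarith
  with eq have "carroll_wave T (\<lambda>t x. \<beta> t x + \<sigma> t x) p q" "carroll_wave T (\<lambda>t x. \<beta> t x - \<sigma> t x) p' q'"
    using w z by (auto simp: carroll_wave_def)
  then show thesis using that signs by blast
qed

text \<open>For exponent 3 the densities are \<open>(w\<^sup>2 - z\<^sup>2) / 4\<close> and
  \<open>(w^3 - z^3) / 6\<close>. Each law is thus half the difference of one scalar law for
  \<open>w\<close> and \<open>z\<close>: \<open>(v\<^sup>2 / 2)_t + v_x = 0\<close> for the first
  and \<open>(v^3 / 3)_t + (v\<^sup>2 / 2)_x = 0\<close> for the second.\<close>

lemma C1_solution_of_waves:
  assumes w: "carroll_wave T w p q" and z: "carroll_wave T z p' q'"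
    and less: "\<And>t x. z t x < w t x"
  shows "C1_solution 3 T (\<lambda>t x. (w t x - z t x) / 2) (\<lambda>t x. (w t x + z t x) / 2)"
proof -
  have W: "C1_partials ({0..<T} \<times> UNIV) w p q" and Z: "C1_partials ({0..<T} \<times> UNIV) z p' q'"
    using w z by (auto simp: carroll_wave_def)
  have "C1_on ({0..<T} \<times> UNIV) (\<lambda>t x. (w t x - z t x) / 2)"
    using C1_partials_linear[OF W Z, of "1/2" "- 1/2"]
    by (auto simp: C1_on_iff_partials diff_divide_distrib)
  moreover have "C1_on ({0..<T} \<times> UNIV) (\<lambda>t x. (w t x + z t x) / 2)"
    using C1_partials_linear[OF W Z, of "1/2" "1/2"]
    by (auto simp: C1_on_iff_partials add_divide_distrib)
  moreover have "carroll_equations_at 3 (\<lambda>t x. (w t x - z t x) / 2) (\<lambda>t x. (w t x + z t x) / 2) t x"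
    if t: "0 < t" "t < T" for t x
  proof -
    note [derivative_intros] =
      C1_partials_chain[OF W t DERIV_const DERIV_ident, of x, simplified]
      C1_partials_chain[OF Z t DERIV_const DERIV_ident, of x, simplified]
      C1_partials_chain[OF W _ _ DERIV_ident DERIV_const, of t x, OF t, simplified]
      C1_partials_chain[OF Z _ _ DERIV_ident DERIV_const, of t x, OF t, simplified]
    have e: "w t x * p (t, x) + q (t, x) = 0" "z t x * p' (t, x) + q' (t, x) = 0"
      using w z t by (auto simp: carroll_wave_def)
    have mass: "(w s y - z s y) / 2 * ((w s y + z s y) / 2) = ((w s y)\<^sup>2 - (z s y)\<^sup>2) / 4" for s y
      by (simp add: field_simps power2_eq_square)
    \<comment> \<open>Turning \<open>powr\<close> into a cube needs a positive base. It is rewritten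
      as an identity of functions of all times, hence \<open>less\<close> for every
      \<open>t\<close>.\<close>
    have energy: "inverse 3 * ((w s y - z s y) / 2) powr 3 + (w s y - z s y) / 2 * ((w s y + z s y) / 2)\<^sup>2
        = ((w s y)^3 - (z s y)^3) / 6" for s y
      using less[of s y] by (simp add: powr_numeral field_simps power2_eq_square power3_eq_cube)
    have "((\<lambda>s. ((w s x)\<^sup>2 - (z s x)\<^sup>2) / 4) has_real_derivative
        (w t x * p (t, x) - z t x * p' (t, x)) / 2) (at t)"
      by (auto intro!: derivative_eq_intros simp: field_simps)
    moreover have "((\<lambda>y. (w t y - z t y) / 2) has_real_derivative (q (t, x) - q' (t, x)) / 2) (at x)"
      by (auto intro!: derivative_eq_intros simp: field_simps)
    moreover have "((\<lambda>s. ((w s x)^3 - (z s x)^3) / 6) has_real_derivative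
        ((w t x)\<^sup>2 * p (t, x) - (z t x)\<^sup>2 * p' (t, x)) / 2) (at t)"
      by (auto intro!: derivative_eq_intros simp: field_simps)
    moreover have "((\<lambda>y. ((w t y)\<^sup>2 - (z t y)\<^sup>2) / 4) has_real_derivative
        (w t x * q (t, x) - z t x * q' (t, x)) / 2) (at x)"
      by (auto intro!: derivative_eq_intros simp: field_simps)
    moreover have "(w t x * p (t, x) - z t x * p' (t, x)) / 2 + (q (t, x) - q' (t, x)) / 2 = 0"
      using e by (simp add: field_simps)
    moreover have "((w t x)\<^sup>2 * p (t, x) - (z t x)\<^sup>2 * p' (t, x)) / 2 +
        (w t x * q (t, x) - z t x * q' (t, x)) / 2 = 0"
      using e by algebra
    ultimately show ?thesis
      unfolding carroll_equations_at_def conservation_law_at_def mass energy by blast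
  qed
  ultimately show ?thesis
    using less by (auto simp: C1_solution_def less_imp_le)
qed

section \<open>Blow-up time and lifespan\<close>

text \<open>Once the denominator is cleared, points with \<open>d x \<le> 0\<close> satisfy the
  inequality for free, so the restricted index set disappears.\<close>

lemma ereal_le_INF_quotient_iff:
  fixes f d :: "real \<Rightarrow> real"
  assumes "0 < T"
  shows "ereal T \<le> (INF x\<in>{x. d x > 0}. ereal ((f x)\<^sup>2 / d x)) \<longleftrightarrow> (\<forall>x. T * d x \<le> (f x)\<^sup>2)"
proof -
  have "T * d x \<le> (f x)\<^sup>2" if "\<not> 0 < d x" for x
    using that assms mult_nonneg_nonpos[of T "d x"] zero_le_power2[of "f x"] by linarith
  then show ?thesis by (auto simp: le_INF_iff pos_le_divide_eq)
qed

lemma Sup_ereal_below: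
  fixes b :: ereal
  assumes "0 \<le> b" "b \<noteq> \<infinity>"
  shows "Sup (insert 0 (ereal ` {T. 0 < T \<and> ereal T \<le> b})) = b"
proof (rule Sup_eqI)
  obtain r where r: "b = ereal r" "0 \<le> r" using assms by (cases b) auto
  show "b \<le> y" if "\<And>z. z \<in> insert 0 (ereal ` {T. 0 < T \<and> ereal T \<le> b}) \<Longrightarrow> z \<le> y" for y
    using that[of b] r by (cases "r = 0") (auto simp: zero_ereal_def)
qed (use assms in auto)

context
  fixes \<sigma>\<^sub>0 \<beta>\<^sub>0 dp dm :: "real \<Rightarrow> real" and c :: real
  assumes dp: "\<And>x. ((\<lambda>y. \<beta>\<^sub>0 y + \<sigma>\<^sub>0 y) has_real_derivative dp x) (at x)"
    and dm: "\<And>x. ((\<lambda>y. \<beta>\<^sub>0 y - \<sigma>\<^sub>0 y) has_real_derivative dm x) (at x)"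
    and cont: "continuous_on UNIV dp" "continuous_on UNIV dm"
    and c: "0 < c" "\<And>x. c \<le> \<sigma>\<^sub>0 x - \<bar>\<beta>\<^sub>0 x\<bar>"
begin

definition carroll_\<sigma> :: "real \<Rightarrow> real \<Rightarrow> real" where
  "carroll_\<sigma> t x = (wave_from (\<lambda>y. \<beta>\<^sub>0 y + \<sigma>\<^sub>0 y) t x - wave_from (\<lambda>y. \<beta>\<^sub>0 y - \<sigma>\<^sub>0 y) t x) / 2"

definition carroll_\<beta> :: "real \<Rightarrow> real \<Rightarrow> real" where
  "carroll_\<beta> t x = (wave_from (\<lambda>y. \<beta>\<^sub>0 y + \<sigma>\<^sub>0 y) t x + wave_from (\<lambda>y. \<beta>\<^sub>0 y - \<sigma>\<^sub>0 y) t x) / 2"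

lemma has_initial_data_carroll: "has_initial_data carroll_\<sigma> carroll_\<beta> \<sigma>\<^sub>0 \<beta>\<^sub>0"
  by (simp add: has_initial_data_def carroll_\<sigma>_def carroll_\<beta>_def wave_from_0)

lemma blowup_time_eq:
  "blowup_time \<sigma>\<^sub>0 \<beta>\<^sub>0 =
     min (INF x\<in>{x. dp x > 0}. ereal ((\<beta>\<^sub>0 x + \<sigma>\<^sub>0 x)\<^sup>2 / dp x))
         (INF x\<in>{x. dm x > 0}. ereal ((\<beta>\<^sub>0 x - \<sigma>\<^sub>0 x)\<^sup>2 / dm x))"
  unfolding blowup_time_def DERIV_imp_deriv[OF dp] DERIV_imp_deriv[OF dm] ..

text \<open>The right-hand side is both what \<open>carroll_wave_wave_from\<close> requires and what
  \<open>carroll_wave_lifespan\<close> yields, so the admissible times are determined exactly,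
  endpoint included.\<close>

lemma le_blowup_time_iff:
  assumes "0 < T"
  shows "ereal T \<le> blowup_time \<sigma>\<^sub>0 \<beta>\<^sub>0 \<longleftrightarrow>
    (\<forall>x. T * dp x \<le> (\<beta>\<^sub>0 x + \<sigma>\<^sub>0 x)\<^sup>2) \<and> (\<forall>x. T * dm x \<le> (\<beta>\<^sub>0 x - \<sigma>\<^sub>0 x)\<^sup>2)"
  unfolding blowup_time_eq by (simp add: ereal_le_INF_quotient_iff[OF assms])

lemma C1_solution_carroll:
  assumes "0 < T" "ereal T \<le> blowup_time \<sigma>\<^sub>0 \<beta>\<^sub>0"
  shows "C1_solution 3 T carroll_\<sigma> carroll_\<beta>"
proof -
  note T = assms(2)[unfolded le_blowup_time_iff[OF assms(1)]]
  have sgn: "c \<le> \<beta>\<^sub>0 y + \<sigma>\<^sub>0 y" "\<beta>\<^sub>0 y - \<sigma>\<^sub>0 y \<le> - c" for y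
    using c(2)[of y] by auto
  have "\<exists>p q. carroll_wave T (wave_from (\<lambda>y. \<beta>\<^sub>0 y + \<sigma>\<^sub>0 y)) p q"
  proof (intro carroll_wave_wave_from[OF dp cont(1) c(1)])
    show "c \<le> \<bar>\<beta>\<^sub>0 y + \<sigma>\<^sub>0 y\<bar>" for y using sgn(1)[of y] by linarith
  qed (use T in auto)
  moreover have "\<exists>p q. carroll_wave T (wave_from (\<lambda>y. \<beta>\<^sub>0 y - \<sigma>\<^sub>0 y)) p q"
  proof (intro carroll_wave_wave_from[OF dm cont(2) c(1)])
    show "c \<le> \<bar>\<beta>\<^sub>0 y - \<sigma>\<^sub>0 y\<bar>" for y using sgn(2)[of y] by linarith
  qed (use T in auto)
  \<comment> \<open>Valid for every real \<open>t\<close>, even where characteristics cross: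
    \<open>wave_from\<close> always takes a value of its data, whatever \<open>foot\<close>
    returns.\<close>
  moreover have "wave_from (\<lambda>y. \<beta>\<^sub>0 y - \<sigma>\<^sub>0 y) t x < wave_from (\<lambda>y. \<beta>\<^sub>0 y + \<sigma>\<^sub>0 y) t x" for t x
    unfolding wave_from_def
    using sgn(2)[of "foot (\<lambda>y. 1 / (\<beta>\<^sub>0 y - \<sigma>\<^sub>0 y)) t x"]
      sgn(1)[of "foot (\<lambda>y. 1 / (\<beta>\<^sub>0 y + \<sigma>\<^sub>0 y)) t x"] c(1) by linarith
  ultimately show ?thesis
    unfolding carroll_\<sigma>_def[abs_def] carroll_\<beta>_def[abs_def]
    by (elim exE) (rule C1_solution_of_waves)
qed

lemma solution_waves:
  assumes sol: "C1_solution 3 T \<sigma> \<beta>" and init: "has_initial_data \<sigma> \<beta> \<sigma>\<^sub>0 \<beta>\<^sub>0"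
  obtains p q p' q' where "carroll_wave T (\<lambda>t x. \<beta> t x + \<sigma> t x) p q"
    "carroll_wave T (\<lambda>t x. \<beta> t x - \<sigma> t x) p' q'"
    "\<And>t x. 0 \<le> t \<Longrightarrow> t < T \<Longrightarrow> \<beta> t x - \<sigma> t x < 0 \<and> 0 < \<beta> t x + \<sigma> t x"
proof (rule C1_solution_waves[OF sol c(1)])
  show "c \<le> \<sigma> 0 x - \<bar>\<beta> 0 x\<bar>" for x
    using c(2) init by (simp add: has_initial_data_def)
qed (rule that)

lemma initial_sign: "\<beta>\<^sub>0 y + \<sigma>\<^sub>0 y \<noteq> 0" "\<beta>\<^sub>0 y - \<sigma>\<^sub>0 y \<noteq> 0"
  using c(1) c(2)[of y] by auto

lemma C1_solution_unique:
  assumes sol: "C1_solution 3 T \<sigma> \<beta>" "has_initial_data \<sigma> \<beta> \<sigma>\<^sub>0 \<beta>\<^sub>0"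
    and sol': "C1_solution 3 T \<sigma>' \<beta>'" "has_initial_data \<sigma>' \<beta>' \<sigma>\<^sub>0 \<beta>\<^sub>0" and t: "0 \<le> t" "t < T"
  shows "\<sigma>' t x = \<sigma> t x \<and> \<beta>' t x = \<beta> t x"
proof -
  obtain p q r s where w: "carroll_wave T (\<lambda>t x. \<beta> t x + \<sigma> t x) p q"
    "carroll_wave T (\<lambda>t x. \<beta> t x - \<sigma> t x) r s"
    by (rule solution_waves[OF sol])
  obtain p' q' r' s' where w': "carroll_wave T (\<lambda>t x. \<beta>' t x + \<sigma>' t x) p' q'"
    "carroll_wave T (\<lambda>t x. \<beta>' t x - \<sigma>' t x) r' s'"
    and signs: "\<And>t x. 0 \<le> t \<Longrightarrow> t < T \<Longrightarrow> \<beta>' t x - \<sigma>' t x < 0 \<and> 0 < \<beta>' t x + \<sigma>' t x"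
    by (rule solution_waves[OF sol']) (rule that)
  have sgn: "\<beta>' t x - \<sigma>' t x < 0" "0 < \<beta>' t x + \<sigma>' t x" using signs[OF t, of x] by auto
  have [simp]: "\<beta> 0 = \<beta>\<^sub>0" "\<sigma> 0 = \<sigma>\<^sub>0" "\<beta>' 0 = \<beta>\<^sub>0" "\<sigma>' 0 = \<sigma>\<^sub>0"
    using sol(2) sol'(2) by (auto simp: has_initial_data_def)
  have "\<beta> t x + \<sigma> t x = \<beta>' t x + \<sigma>' t x"
    using carroll_wave_unique[OF w(1) w'(1) _ _ _ t, of x] sgn initial_sign by simp
  moreover have "\<beta> t x - \<sigma> t x = \<beta>' t x - \<sigma>' t x"
    using carroll_wave_unique[OF w(2) w'(2) _ _ _ t, of x] sgn initial_sign by simp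
  ultimately show ?thesis by auto
qed

lemma C1_solution_le_blowup_time:
  assumes sol: "C1_solution 3 T \<sigma> \<beta>" "has_initial_data \<sigma> \<beta> \<sigma>\<^sub>0 \<beta>\<^sub>0" and "0 < T"
  shows "ereal T \<le> blowup_time \<sigma>\<^sub>0 \<beta>\<^sub>0"
proof -
  obtain p q r s where w: "carroll_wave T (\<lambda>t x. \<beta> t x + \<sigma> t x) p q"
    "carroll_wave T (\<lambda>t x. \<beta> t x - \<sigma> t x) r s"
    by (rule solution_waves[OF sol])
  have [simp]: "\<beta> 0 = \<beta>\<^sub>0" "\<sigma> 0 = \<sigma>\<^sub>0" using sol(2) by (auto simp: has_initial_data_def)
  show ?thesis
    using carroll_wave_lifespan[OF w(1) _ _ \<open>0 < T\<close>] carroll_wave_lifespan[OF w(2) _ _ \<open>0 < T\<close>]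
      initial_sign dp dm
    by (simp add: le_blowup_time_iff[OF \<open>0 < T\<close>])
qed

lemma C1_lifespan_eq_blowup_time:
  assumes "blowup_time \<sigma>\<^sub>0 \<beta>\<^sub>0 \<noteq> \<infinity>"
  shows "C1_lifespan 3 \<sigma>\<^sub>0 \<beta>\<^sub>0 = blowup_time \<sigma>\<^sub>0 \<beta>\<^sub>0"
proof -
  have "{T. 0 < T \<and> (\<exists>\<sigma> \<beta>. C1_solution 3 T \<sigma> \<beta> \<and> has_initial_data \<sigma> \<beta> \<sigma>\<^sub>0 \<beta>\<^sub>0)} =
      {T. 0 < T \<and> ereal T \<le> blowup_time \<sigma>\<^sub>0 \<beta>\<^sub>0}"
    using C1_solution_le_blowup_time C1_solution_carroll has_initial_data_carroll by blast
  \<comment> \<open>The value 0 is possible, because the derivatives of the data may be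
    unbounded.\<close>
  moreover have "0 \<le> blowup_time \<sigma>\<^sub>0 \<beta>\<^sub>0"
    unfolding blowup_time_eq by (auto intro!: INF_greatest)
  ultimately show ?thesis
    using Sup_ereal_below[OF _ assms] by (simp add: C1_lifespan_def)
qed

lemma blowup_time_infinite_iff:
  "blowup_time \<sigma>\<^sub>0 \<beta>\<^sub>0 = \<infinity> \<longleftrightarrow> (\<forall>x. dp x \<le> 0) \<and> (\<forall>x. dm x \<le> 0)"
proof
  assume inf: "blowup_time \<sigma>\<^sub>0 \<beta>\<^sub>0 = \<infinity>"
  have "blowup_time \<sigma>\<^sub>0 \<beta>\<^sub>0 \<le> ereal ((\<beta>\<^sub>0 x + \<sigma>\<^sub>0 x)\<^sup>2 / dp x)" if "0 < dp x" for x
    unfolding blowup_time_eq using that by (intro min.coboundedI1 INF_lower) simp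
  moreover have "blowup_time \<sigma>\<^sub>0 \<beta>\<^sub>0 \<le> ereal ((\<beta>\<^sub>0 x - \<sigma>\<^sub>0 x)\<^sup>2 / dm x)" if "0 < dm x" for x
    unfolding blowup_time_eq using that by (intro min.coboundedI2 INF_lower) simp
  ultimately have "\<not> 0 < dp x" "\<not> 0 < dm x" for x
    using inf by auto
  then show "(\<forall>x. dp x \<le> 0) \<and> (\<forall>x. dm x \<le> 0)" by (auto simp: not_less)
next
  assume "(\<forall>x. dp x \<le> 0) \<and> (\<forall>x. dm x \<le> 0)"
  then have "{x. 0 < dp x} = {}" "{x. 0 < dm x} = {}" by (auto simp: not_less)
  then show "blowup_time \<sigma>\<^sub>0 \<beta>\<^sub>0 = \<infinity>" unfolding blowup_time_eq by (simp add: top_ereal_def)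
qed

lemma unique_global_C1_solution_iff:
  "unique_global_C1_solution 3 \<sigma>\<^sub>0 \<beta>\<^sub>0 \<longleftrightarrow> blowup_time \<sigma>\<^sub>0 \<beta>\<^sub>0 = \<infinity>"
proof
  assume "unique_global_C1_solution 3 \<sigma>\<^sub>0 \<beta>\<^sub>0"
  then have "ereal T \<le> blowup_time \<sigma>\<^sub>0 \<beta>\<^sub>0" if "0 < T" for T
    using that C1_solution_le_blowup_time
    unfolding unique_global_C1_solution_def global_C1_solution_def by blast
  \<comment> \<open>The bound is known for positive times only, while \<open>ereal_top\<close> asks
    for every real number.\<close>
  from this[of "max T 1" for T] have "ereal T \<le> blowup_time \<sigma>\<^sub>0 \<beta>\<^sub>0" for T
    by (rule order_trans[of _ "ereal (max T 1)", rotated]) auto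
  then show "blowup_time \<sigma>\<^sub>0 \<beta>\<^sub>0 = \<infinity>" by (intro ereal_top) auto
next
  assume inf: "blowup_time \<sigma>\<^sub>0 \<beta>\<^sub>0 = \<infinity>"
  then have glob: "global_C1_solution 3 carroll_\<sigma> carroll_\<beta>"
    by (simp add: global_C1_solution_def C1_solution_carroll)
  have "\<sigma>' t x = carroll_\<sigma> t x \<and> \<beta>' t x = carroll_\<beta> t x"
    if "global_C1_solution 3 \<sigma>' \<beta>'" "has_initial_data \<sigma>' \<beta>' \<sigma>\<^sub>0 \<beta>\<^sub>0" "0 \<le> t" for \<sigma>' \<beta>' t x
    using that glob unfolding global_C1_solution_def
    by (intro C1_solution_unique[of "t + 1"] has_initial_data_carroll) auto
  with glob has_initial_data_carroll show "unique_global_C1_solution 3 \<sigma>\<^sub>0 \<beta>\<^sub>0"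
    unfolding unique_global_C1_solution_def by blast
qed

text \<open>The scalar bound involves the datum at a foot depending on \<open>(t, x)\<close>; the
  supremum removes this dependence. Positivity of \<open>\<sigma>\<^sub>0\<close> puts both
  invariants below \<open>\<sigma>\<^sub>0 + |\<beta>\<^sub>0|\<close> in modulus.\<close>

lemma one_sided_Lipschitz:
  assumes sol: "C1_solution 3 T \<sigma> \<beta>" "has_initial_data \<sigma> \<beta> \<sigma>\<^sub>0 \<beta>\<^sub>0" and t: "0 < t" "t < T"
  shows "- ((SUP x. ereal ((\<sigma>\<^sub>0 x + \<bar>\<beta>\<^sub>0 x\<bar>)\<^sup>2)) / ereal t) \<le> ereal (deriv (\<lambda>y. \<beta> t y + \<sigma> t y) x)"
    and "- ((SUP x. ereal ((\<sigma>\<^sub>0 x + \<bar>\<beta>\<^sub>0 x\<bar>)\<^sup>2)) / ereal t) \<le> ereal (deriv (\<lambda>y. \<beta> t y - \<sigma> t y) x)"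
proof -
  obtain p q r s where w: "carroll_wave T (\<lambda>t x. \<beta> t x + \<sigma> t x) p q"
    "carroll_wave T (\<lambda>t x. \<beta> t x - \<sigma> t x) r s"
    and signs: "\<And>t x. 0 \<le> t \<Longrightarrow> t < T \<Longrightarrow> \<beta> t x - \<sigma> t x < 0 \<and> 0 < \<beta> t x + \<sigma> t x"
    by (rule solution_waves[OF sol]) (rule that)
  have sgn: "\<beta> t x - \<sigma> t x < 0" "0 < \<beta> t x + \<sigma> t x" using signs[of t x] t by auto
  have [simp]: "\<beta> 0 = \<beta>\<^sub>0" "\<sigma> 0 = \<sigma>\<^sub>0" using sol(2) by (auto simp: has_initial_data_def)
  have bound: "- ((SUP x. ereal ((\<sigma>\<^sub>0 x + \<bar>\<beta>\<^sub>0 x\<bar>)\<^sup>2)) / ereal t) \<le> ereal d"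
    if ex: "\<exists>y. - ((f y)\<^sup>2 / t) \<le> d" and f: "\<And>y. \<bar>f y\<bar> \<le> \<sigma>\<^sub>0 y + \<bar>\<beta>\<^sub>0 y\<bar>" for f :: "real \<Rightarrow> real" and d
  proof -
    obtain y where y: "- ((f y)\<^sup>2 / t) \<le> d" using ex by blast
    have "(f y)\<^sup>2 \<le> (\<sigma>\<^sub>0 y + \<bar>\<beta>\<^sub>0 y\<bar>)\<^sup>2"
      using f[of y] by (metis abs_ge_zero power2_abs power_mono)
    then have "ereal ((f y)\<^sup>2) \<le> (SUP x. ereal ((\<sigma>\<^sub>0 x + \<bar>\<beta>\<^sub>0 x\<bar>)\<^sup>2))"
      by (intro SUP_upper2[of y]) auto
    then have "ereal ((f y)\<^sup>2) / ereal t \<le> (SUP x. ereal ((\<sigma>\<^sub>0 x + \<bar>\<beta>\<^sub>0 x\<bar>)\<^sup>2)) / ereal t"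
      using t by (intro ereal_divide_right_mono) auto
    then have "- ((SUP x. ereal ((\<sigma>\<^sub>0 x + \<bar>\<beta>\<^sub>0 x\<bar>)\<^sup>2)) / ereal t) \<le> - (ereal ((f y)\<^sup>2) / ereal t)"
      by simp
    also have "\<dots> \<le> ereal d" using y t by simp
    finally show ?thesis .
  qed
  have abs: "\<bar>\<beta>\<^sub>0 y + \<sigma>\<^sub>0 y\<bar> \<le> \<sigma>\<^sub>0 y + \<bar>\<beta>\<^sub>0 y\<bar>" "\<bar>\<beta>\<^sub>0 y - \<sigma>\<^sub>0 y\<bar> \<le> \<sigma>\<^sub>0 y + \<bar>\<beta>\<^sub>0 y\<bar>" for y
    using c(1) c(2)[of y] by auto
  have diff: "(\<lambda>y. \<beta>\<^sub>0 y + \<sigma>\<^sub>0 y) differentiable at y" "(\<lambda>y. \<beta>\<^sub>0 y - \<sigma>\<^sub>0 y) differentiable at y" for y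
    using dp dm real_differentiable_def by blast+
  show "- ((SUP x. ereal ((\<sigma>\<^sub>0 x + \<bar>\<beta>\<^sub>0 x\<bar>)\<^sup>2)) / ereal t) \<le> ereal (deriv (\<lambda>y. \<beta> t y + \<sigma> t y) x)"
    using carroll_wave_one_sided_bound[OF w(1) _ _ _ t, of x] initial_sign sgn diff
    by (intro bound[OF _ abs(1)]) simp
  show "- ((SUP x. ereal ((\<sigma>\<^sub>0 x + \<bar>\<beta>\<^sub>0 x\<bar>)\<^sup>2)) / ereal t) \<le> ereal (deriv (\<lambda>y. \<beta> t y - \<sigma> t y) x)"
    using carroll_wave_one_sided_bound[OF w(2) _ _ _ t, of x] initial_sign sgn diff
    by (intro bound[OF _ abs(2)]) simp
qed

end


theorem theorem2p1:
  fixes \<sigma>\<^sub>0 \<beta>\<^sub>0 :: "real \<Rightarrow> real"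
  assumes "Linfinity \<sigma>\<^sub>0" and "Linfinity \<beta>\<^sub>0"
    and "\<sigma>\<^sub>0 C1_differentiable_on UNIV" and "\<beta>\<^sub>0 C1_differentiable_on UNIV"
    and "(INF x. ereal (\<sigma>\<^sub>0 x - \<bar>\<beta>\<^sub>0 x\<bar>)) > 0"
  defines "cond \<equiv> (\<forall>x. deriv (\<lambda>y. \<beta>\<^sub>0 y + \<sigma>\<^sub>0 y) x \<le> 0) \<and> (\<forall>x. deriv (\<lambda>y. \<beta>\<^sub>0 y - \<sigma>\<^sub>0 y) x \<le> 0)"
  shows "(unique_global_C1_solution 3 \<sigma>\<^sub>0 \<beta>\<^sub>0 \<longleftrightarrow> cond) \<and>
    (\<not> cond \<longrightarrow> C1_lifespan 3 \<sigma>\<^sub>0 \<beta>\<^sub>0 = blowup_time \<sigma>\<^sub>0 \<beta>\<^sub>0) \<and>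
    (\<forall>T>0. \<forall>\<sigma> \<beta>. C1_solution 3 T \<sigma> \<beta> \<and> has_initial_data \<sigma> \<beta> \<sigma>\<^sub>0 \<beta>\<^sub>0 \<longrightarrow>
      (\<forall>t. 0 < t \<and> t < T \<and> ereal t < blowup_time \<sigma>\<^sub>0 \<beta>\<^sub>0 \<longrightarrow>
         (INF x. ereal (deriv (\<lambda>y. \<beta> t y + \<sigma> t y) x))
           \<ge> - ((SUP x. ereal ((\<sigma>\<^sub>0 x + \<bar>\<beta>\<^sub>0 x\<bar>)\<^sup>2)) / ereal t) \<and>
         (INF x. ereal (deriv (\<lambda>y. \<beta> t y - \<sigma> t y) x))
           \<ge> - ((SUP x. ereal ((\<sigma>\<^sub>0 x + \<bar>\<beta>\<^sub>0 x\<bar>)\<^sup>2)) / ereal t)))"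
proof -
  obtain ds db where ds: "\<And>x. (\<sigma>\<^sub>0 has_real_derivative ds x) (at x)" "continuous_on UNIV ds"
    and db: "\<And>x. (\<beta>\<^sub>0 has_real_derivative db x) (at x)" "continuous_on UNIV db"
    using assms(3,4)
    by (auto simp: C1_differentiable_on_def has_real_derivative_iff_has_vector_derivative)
  \<comment> \<open>A real number strictly below the extended-real infimum supplies the uniform gap
    from vacuum.\<close>
  obtain c where "0 < ereal c" and "ereal c < (INF x. ereal (\<sigma>\<^sub>0 x - \<bar>\<beta>\<^sub>0 x\<bar>))"
    using ereal_dense2[OF assms(5)] by blast
  then have c: "0 < c" "c \<le> \<sigma>\<^sub>0 x - \<bar>\<beta>\<^sub>0 x\<bar>" for x
    using less_INF_D[of "ereal c" "\<lambda>x. ereal (\<sigma>\<^sub>0 x - \<bar>\<beta>\<^sub>0 x\<bar>)" UNIV x] by auto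
  have dp: "((\<lambda>y. \<beta>\<^sub>0 y + \<sigma>\<^sub>0 y) has_real_derivative db x + ds x) (at x)"
    and dm: "((\<lambda>y. \<beta>\<^sub>0 y - \<sigma>\<^sub>0 y) has_real_derivative db x - ds x) (at x)" for x
    by (auto intro!: derivative_intros ds db)
  have cont: "continuous_on UNIV (\<lambda>x. db x + ds x)" "continuous_on UNIV (\<lambda>x. db x - ds x)"
    by (auto intro!: continuous_intros ds db)
  note data = dp dm cont c
  have "cond \<longleftrightarrow> blowup_time \<sigma>\<^sub>0 \<beta>\<^sub>0 = \<infinity>"
    unfolding cond_def DERIV_imp_deriv[OF dp] DERIV_imp_deriv[OF dm]
    using blowup_time_infinite_iff[OF data] by simp
  then show ?thesis
    using unique_global_C1_solution_iff[OF data] C1_lifespan_eq_blowup_time[OF data]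
      one_sided_Lipschitz[OF data]
    by (auto intro!: INF_greatest)
qed

end
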